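(* Every ($2K_2$, diamond)-free graph $G$ on $n$ vertices is recolorable, and the diameter of $R_\ell(G)$ is at most $2n^2$ for all $\ell\ge\chi(G)+1$.
   Context: All graphs are finite and simple. A $k$-coloring of $G$ is a map $V(G)\to\{1,\dots,k\}$ giving adjacent vertices different values; $\chi(G)$ is the chromatic number. $R_k(G)$ denotes the graph whose vertices are the $k$-colorings of $G$, two being adjacent if they differ in color on exactly one vertex. $G$ is recolorable if $R_\ell(G)$ is connected for all $\ell\ge\chi(G)+1$. A graph is $(H_1,H_2)$-free if it has no induced subgraph isomorphic to $H_1$ or $H_2$. $2K_2$ is the disjoint union of two edges; the diamond is $K_4$ minus an edge. *)

theory Defs
  imports "Graph_Theory.Graph_Theory" "HOL-Library.FuncSet"
begin

text \<open>
  Finite simple graphs are given by the locale \<open>pair_graph\<close>: an undirected edge \<open>uv\<close> is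
  represented by the two arcs \<open>(u, v)\<close> and \<open>(v, u)\<close>.
\<close>

definition two_K2 :: "nat pair_pre_digraph" where
  "two_K2 = \<lparr>pverts = {0, 1, 2, 3}, parcs = symcl {(0, 1), (2, 3)}\<rparr>"

definition diamond :: "nat pair_pre_digraph" where
  "diamond = \<lparr>pverts = {0, 1, 2, 3},
    parcs = {(u, v) \<in> {0, 1, 2, 3} \<times> {0, 1, 2, 3}. u \<noteq> v} - {(2, 3), (3, 2)}\<rparr>"

definition free_of :: "'b pair_pre_digraph \<Rightarrow> 'a pair_pre_digraph \<Rightarrow> bool" where
  "free_of H G \<longleftrightarrow>
    \<not> (\<exists>K. induced_subgraph K (with_proj G) \<and> digraph_iso K (with_proj H))"

text \<open>Colorings are extensional functions, so that they are determined by their values on the vertices.\<close>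

definition colorings :: "'a pair_pre_digraph \<Rightarrow> nat \<Rightarrow> ('a \<Rightarrow> nat) set" where
  "colorings G k = {c \<in> pverts G \<rightarrow>\<^sub>E {1..k}. \<forall>(u, v) \<in> parcs G. c u \<noteq> c v}"

definition chromatic_number :: "'a pair_pre_digraph \<Rightarrow> nat" where
  "chromatic_number G = (LEAST k. colorings G k \<noteq> {})"

definition recoloring_graph :: "'a pair_pre_digraph \<Rightarrow> nat \<Rightarrow> ('a \<Rightarrow> nat) pair_pre_digraph" where
  "recoloring_graph G k = \<lparr>pverts = colorings G k,
    parcs = {(c, d) \<in> colorings G k \<times> colorings G k. \<exists>!v. v \<in> pverts G \<and> c v \<noteq> d v}\<rparr>"

text \<open>
  \<open>Topological_Spaces.connected\<close> is in scope as well, hence the qualified name.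
\<close>

definition recolorable :: "'a pair_pre_digraph \<Rightarrow> bool" where
  "recolorable G \<longleftrightarrow>
    (\<forall>l \<ge> chromatic_number G + 1. Digraph_Component.connected (with_proj (recoloring_graph G l)))"

text \<open>
  The length of a shortest walk is the least cost with respect to unit arc weights. It is
  \<open>\<infinity>\<close> if there is no walk, so the diameter of a disconnected graph is \<open>\<infinity>\<close>. The value for
  the graph without vertices is \<open>-\<infinity>\<close>.
\<close>

definition diameter :: "'a pair_pre_digraph \<Rightarrow> ereal" where
  "diameter G =
    (SUP (u, v) \<in> pverts G \<times> pverts G. wf_digraph.\<mu> (with_proj G) (\<lambda>_. 1) u v)"

lemma pair_graph_two_K2: "pair_graph two_K2"
  by unfold_locales (auto simp: two_K2_def symcl_def symmetric_def sym_def)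

lemma pair_graph_diamond: "pair_graph diamond"
proof -
  have "finite (parcs diamond)"
    by (rule finite_subset[of _ "{0, 1, 2, 3} \<times> {0, 1, 2, 3}"]) (auto simp: diamond_def)
  then show ?thesis
    by unfold_locales (auto simp: diamond_def symmetric_def sym_def)
qed

lemma finite_colorings: "finite (pverts G) \<Longrightarrow> finite (colorings G k)"
  unfolding colorings_def by (rule finite_subset[of _ "pverts G \<rightarrow>\<^sub>E {1..k}"]) (auto intro: finite_PiE)

lemma pair_graph_recoloring_graph:
  assumes "pair_graph G"
  shows "pair_graph (recoloring_graph G k)"
proof -
  interpret pair_graph G by fact
  have fin: "finite (colorings G k)"
    using pair_finite_verts by (rule finite_colorings)
  have "finite (parcs (recoloring_graph G k))"
    by (rule finite_subset[of _ "colorings G k \<times> colorings G k"])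
      (use fin in \<open>auto simp: recoloring_graph_def\<close>)
  then show ?thesis
    using fin
    by unfold_locales (auto simp: recoloring_graph_def symmetric_def sym_def eq_commute)
qed

lemma colorings_chromatic_number_nonempty:
  assumes "pair_graph G"
  shows "colorings G (chromatic_number G) \<noteq> {}"
proof -
  interpret pair_graph G by fact
  obtain f where f: "bij_betw f (pverts G) {1..card (pverts G)}"
    using finite_same_card_bij[OF pair_finite_verts, of "{1..card (pverts G)}"] by auto
  have "restrict f (pverts G) \<in> colorings G (card (pverts G))"
    unfolding colorings_def
  proof (intro CollectI conjI ballI, goal_cases)
    case 1
    show ?case using bij_betw_imp_surj_on[OF f] by auto
  next
    case (2 e)
    obtain u v where e: "e = (u, v)" by (cases e)
    have "u \<in> pverts G" "v \<in> pverts G" "u \<noteq> v"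
      using 2 arc_fst_in_verts[of e] arc_snd_in_verts[of e] pair_no_loops[of e] by (auto simp: e)
    then show ?case
      using inj_onD[OF bij_betw_imp_inj_on[OF f], of u v] by (auto simp: e)
  qed
  then have "\<exists>k. colorings G k \<noteq> {}" by blast
  then show ?thesis
    unfolding chromatic_number_def by (rule LeastI_ex)
qed

end

theory Submission
  imports Defs
begin

text \<open>
  We show by induction on the number \<open>n\<close> of vertices that any two colorings are joined by a
  sequence that recolors every vertex at most \<open>2 * n\<close> times. If \<open>N(u) \<subseteq> N(v)\<close>, then \<open>u\<close> can
  imitate \<open>v\<close>, and removing \<open>u\<close> costs two further moves at \<open>u\<close>. If there are no such \<open>u\<close> and
  \<open>v\<close>, then the graph is complete, a 5-cycle, or consists of a triangle \<open>abc\<close> and further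
  vertices, each with exactly one neighbor in the triangle. In the last case the vertices outside
  the triangle can be moved, one after the other, to the colors of the triangle, and then to the
  color classes of a fixed 3-coloring. Two colorings with the same color classes, one color being
  free, are joined by at most two moves at each vertex.
\<close>

section \<open>Recoloring sequences\<close>

text \<open>The number of moves is bounded per vertex and not in total: an imitating vertex copies
  the count of another one, which leaves the maximum unchanged but not the sum. Summing at the very
  end gives \<open>2 * n ^ 2\<close>.

  The triangle case exhausts this budget. Each of the \<open>n - 3\<close> outer vertices may cost
  one round, the fixed 3-coloring costs two moves, both from either end, and the permutation of the
  colors costs two: \<open>2 * ((n - 3) + 2) + 2 = 2 * n\<close>. The obstacle is an outer vertex
  that cannot take a triangle color even after its neighbors have made room. It would have to be
  blocked for two triangle colors at once, and the two obstructions together are incompatible with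
  the forbidden subgraphs.

  The relation \<open>E\<close> is fixed, while the vertices \<open>S\<close> and the colors
  \<open>L\<close> are parameters, because the induction deletes vertices and the permutation
  argument deletes colors as well. The bound on the chromatic number is carried along as a proper
  coloring with fewer than \<open>card L\<close> colors, a condition inherited by subsets of
  \<open>S\<close>.\<close>

locale simple_graph =
  fixes E :: "'a \<Rightarrow> 'a \<Rightarrow> bool"
  assumes sym: "E u v \<Longrightarrow> E v u"
    and irrefl: "\<not> E u u"
begin

definition proper :: "'a set \<Rightarrow> nat set \<Rightarrow> ('a \<Rightarrow> nat) \<Rightarrow> bool" where
  "proper S L c \<longleftrightarrow> (\<forall>v\<in>S. c v \<in> L) \<and> (\<forall>u\<in>S. \<forall>v\<in>S. E u v \<longrightarrow> c u \<noteq> c v)"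

text \<open>In \<open>recolors S L c n d\<close>, the number \<open>n v\<close> counts the moves at the vertex \<open>v\<close>. Moves
  that do not change the color are allowed.\<close>

inductive recolors :: "'a set \<Rightarrow> nat set \<Rightarrow> ('a \<Rightarrow> nat) \<Rightarrow> ('a \<Rightarrow> nat) \<Rightarrow> ('a \<Rightarrow> nat) \<Rightarrow> bool"
  for S L c where
  refl: "recolors S L c (\<lambda>_. 0) c"
| step: "recolors S L c n d \<Longrightarrow> v \<in> S \<Longrightarrow> x \<in> L \<Longrightarrow> (\<And>u. u \<in> S \<Longrightarrow> E u v \<Longrightarrow> d u \<noteq> x)
    \<Longrightarrow> recolors S L c (n(v := Suc (n v))) (d(v := x))"

definition reaches :: "'a set \<Rightarrow> nat set \<Rightarrow> nat \<Rightarrow> ('a \<Rightarrow> nat) \<Rightarrow> ('a \<Rightarrow> nat) \<Rightarrow> bool" where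
  "reaches S L k c d \<longleftrightarrow> (\<exists>n. recolors S L c n d \<and> (\<forall>v. n v \<le> k))"

section \<open>Composing, reversing and extending sequences\<close>

lemma recolors_proper:
  assumes "recolors S L c n d" "proper S L c"
  shows "proper S L d"
  using assms
proof induction
  case (step n d v x)
  then show ?case unfolding proper_def using sym[of v] by (simp, metis)
qed

lemma recolors_outside:
  assumes "recolors S L c n d" "v \<notin> S"
  shows "d v = c v" and "n v = 0"
  using assms by (induction) auto

lemma recolors_trans:
  assumes "recolors S L d m e" "recolors S L c n d"
  shows "recolors S L c (\<lambda>v. n v + m v) e"
  using assms
proof induction
  case (step m e v x)
  have "recolors S L c ((\<lambda>v. n v + m v)(v := Suc (n v + m v))) (e(v := x))"
    by (rule recolors.step) (use step in auto)
  then show ?case by (rule back_subst[of "\<lambda>n. recolors S L c n _"]) auto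
qed auto

lemma recolors_single:
  assumes "v \<in> S" "x \<in> L" "\<And>u. u \<in> S \<Longrightarrow> E u v \<Longrightarrow> c u \<noteq> x"
  shows "recolors S L c (\<lambda>u. if u = v then 1 else 0) (c(v := x))"
  using recolors.step[OF recolors.refl assms]
  by (rule back_subst[of "\<lambda>n. recolors S L c n _"]) auto

lemma recolors_sym:
  assumes "recolors S L c n d" "proper S L c"
  shows "recolors S L d n c"
  using assms
proof induction
  case refl
  show ?case by (rule recolors.refl)
next
  case (step n d v x)
  have "proper S L d" using recolors_proper step by blast
  then have "recolors S L (d(v := x)) (\<lambda>u. if u = v then 1 else 0) ((d(v := x))(v := d v))"
    using step by (intro recolors_single) (auto simp: proper_def irrefl)
  then have "recolors S L (d(v := x)) (\<lambda>u. (if u = v then 1 else 0) + n u) c"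
    using recolors_trans[OF step.IH[OF step.prems]] by simp
  then show ?case by (rule back_subst[of "\<lambda>n. recolors S L _ n c"]) auto
qed

text \<open>No old color at one end of an edge equals the new color at the other, so every mixture
  of \<open>c\<close> and \<open>d\<close> is proper and the vertices can be moved in any
  order.\<close>

lemma recolors_compatible:
  assumes "finite S" "proper S L c" "proper S L d"
    and outside: "\<And>v. v \<notin> S \<Longrightarrow> c v = d v"
    and compatible: "\<And>u v. u \<in> S \<Longrightarrow> v \<in> S \<Longrightarrow> E u v \<Longrightarrow> c u \<noteq> d v"
  shows "recolors S L c (\<lambda>v. if c v = d v then 0 else 1) d"
proof -
  have "finite T \<Longrightarrow> T \<subseteq> S \<Longrightarrow> (\<And>v. v \<in> T \<Longrightarrow> c v \<noteq> d v) \<Longrightarrow>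
    recolors S L c (\<lambda>v. if v \<in> T then 1 else 0) (\<lambda>v. if v \<in> T then d v else c v)" for T
  proof (induction T rule: finite_induct)
    case empty
    then show ?case by (simp add: recolors.refl)
  next
    case (insert x T)
    let ?n = "\<lambda>v. if v \<in> T then 1 else 0 :: nat" and ?e = "\<lambda>v. if v \<in> T then d v else c v"
    have "recolors S L c (?n(x := Suc (?n x))) (?e(x := d x))"
      using insert assms(2,3) compatible by (intro recolors.step) (auto simp: proper_def)
    moreover have "?n(x := Suc (?n x)) = (\<lambda>v. if v \<in> insert x T then 1 else 0)"
      and "?e(x := d x) = (\<lambda>v. if v \<in> insert x T then d v else c v)"
      using insert by auto
    ultimately show ?case by simp
  qed
  note diff = this
  let ?T = "{v\<in>S. c v \<noteq> d v}"
  have "recolors S L c (\<lambda>v. if v \<in> ?T then 1 else 0) (\<lambda>v. if v \<in> ?T then d v else c v)"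
    by (rule diff) (use assms(1) in auto)
  moreover have "(\<lambda>v. if v \<in> ?T then 1 else 0) = (\<lambda>v. if c v = d v then 0 else 1 :: nat)"
    using outside by (intro ext) auto
  moreover have "(\<lambda>v. if v \<in> ?T then d v else c v) = d"
    using outside by (intro ext) auto
  ultimately show ?thesis by simp
qed

lemma recolors_set:
  fixes f :: "'a \<Rightarrow> nat"
  assumes "finite S" and f: "proper S L f" and T: "T \<subseteq> S" and k: "k \<in> L"
    and free: "\<And>u v. u \<in> S \<Longrightarrow> v \<in> T \<Longrightarrow> E u v \<Longrightarrow> u \<notin> T \<and> f u \<noteq> k"
  defines "g \<equiv> \<lambda>v. if v \<in> T then k else f v"
  shows "proper S L g" "recolors S L f (\<lambda>v. if f v = g v then 0 else 1) g"
proof -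
  have ne: "f u \<noteq> f v" if "u \<in> S" "v \<in> S" "E u v" for u v
    using f that unfolding proper_def by blast
  have edge: "g u \<noteq> g v \<and> f u \<noteq> g v" if "u \<in> S" "v \<in> S" "E u v" for u v
    using ne[OF that] free[of u v] free[of v u] that sym[of u v]
    unfolding g_def by (cases "u \<in> T"; cases "v \<in> T") auto
  then show g: "proper S L g"
    using f k unfolding proper_def g_def by auto
  show "recolors S L f (\<lambda>v. if f v = g v then 0 else 1) g"
    by (rule recolors_compatible[OF assms(1) f g]) (use edge T g_def in auto)
qed

text \<open>The added vertices never move and their colors lie outside the smaller palette, so they
  cannot obstruct any move.\<close>

lemma recolors_mono:
  assumes "recolors S' L' c n d" "S' \<subseteq> S" "L' \<subseteq> L"
    and "\<And>v. v \<in> S - S' \<Longrightarrow> c v \<notin> L'"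
  shows "recolors S L c n d"
  using assms(1)
proof induction
  case refl
  show ?case by (rule recolors.refl)
next
  case (step n d v x)
  have "d u \<noteq> x" if "u \<in> S" "E u v" for u
  proof (cases "u \<in> S'")
    case True
    then show ?thesis using step that by auto
  next
    case False
    then have "d u = c u" using recolors_outside[OF step.hyps(1)] by auto
    then show ?thesis using assms(4)[of u] False that step.hyps by auto
  qed
  then show ?case using step assms by (intro recolors.step) auto
qed

section \<open>Uniform bounds on the number of moves\<close>

lemma reaches_refl: "reaches S L k c c"
  unfolding reaches_def using recolors.refl by force

lemma reaches_trans:
  assumes "reaches S L j c d" "reaches S L k d e"
  shows "reaches S L (j + k) c e"
proof -
  obtain n m where "recolors S L c n d" "\<forall>v. n v \<le> j" "recolors S L d m e" "\<forall>v. m v \<le> k"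
    using assms unfolding reaches_def by blast
  then show ?thesis
    unfolding reaches_def
    by (intro exI[of _ "\<lambda>v. n v + m v"]) (auto intro: recolors_trans add_mono)
qed

lemma reaches_sym: "reaches S L k c d \<Longrightarrow> proper S L c \<Longrightarrow> reaches S L k d c"
  unfolding reaches_def using recolors_sym by blast

lemma reaches_le: "reaches S L j c d \<Longrightarrow> j \<le> k \<Longrightarrow> reaches S L k c d"
  unfolding reaches_def using le_trans by blast

lemma reaches_outside: "reaches S L k c d \<Longrightarrow> v \<notin> S \<Longrightarrow> d v = c v"
  unfolding reaches_def using recolors_outside by blast

lemma reaches_proper: "reaches S L k c d \<Longrightarrow> proper S L c \<Longrightarrow> proper S L d"
  unfolding reaches_def using recolors_proper by blast

lemma proper_subset: "proper S L c \<Longrightarrow> S' \<subseteq> S \<Longrightarrow> proper S' L c"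
  unfolding proper_def by blast

subsection \<open>Dominated vertices\<close>

text \<open>The vertex \<open>u\<close> follows every move of \<open>v\<close>. Its neighbors are
  neighbors of \<open>v\<close>, so a color free for \<open>v\<close> is free for \<open>u\<close>;
  and a vertex next to \<open>u\<close> already avoids the color that \<open>u\<close> shares with
  \<open>v\<close>.\<close>

lemma recolors_duplicate:
  assumes "recolors (S - {u}) L c n d" "v \<in> S" "u \<in> S" "u \<noteq> v"
    and dominated: "\<And>w. w \<in> S \<Longrightarrow> E w u \<Longrightarrow> E w v"
  shows "recolors S L (c(u := c v)) (n(u := n v)) (d(u := d v))"
  using assms(1)
proof induction
  case refl
  have "(\<lambda>_. 0)(u := 0 :: nat) = (\<lambda>_. 0)" by auto
  then show ?case by (simp add: recolors.refl)
next
  case (step n d w x)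
  have nuv: "\<not> E v u" "\<not> E u v" using dominated[of v] irrefl assms(2) sym by blast+
  show ?case
  proof (cases "w = v")
    case True
    let ?n = "n(u := Suc (n v))" and ?d = "d(u := x)"
    \<comment> \<open>Here \<open>u\<close> moves ahead of \<open>v\<close>. By \<open>nuv\<close>
      they are not adjacent, so they may differ for a moment.\<close>
    have "recolors S L (c(u := c v)) ((n(u := n v))(u := Suc ((n(u := n v)) u))) ((d(u := d v))(u := x))"
    proof (rule recolors.step[OF step.IH])
      fix z assume "z \<in> S" "E z u"
      then show "(d(u := d v)) z \<noteq> x"
        using step.hyps dominated[of z] True irrefl by auto
    qed (use assms step.hyps in auto)
    then have "recolors S L (c(u := c v)) ?n ?d" by simp
    then have "recolors S L (c(u := c v)) (?n(v := Suc (?n v))) (?d(v := x))"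
    proof (rule recolors.step)
      fix z assume "z \<in> S" "E z v"
      then show "?d z \<noteq> x" using step.hyps True nuv by auto
    qed (use assms step.hyps in auto)
    then have "recolors S L (c(u := c v)) ((n(u := Suc (n v)))(v := Suc (n v))) ((d(u := x))(v := x))"
      using assms by simp
    moreover have "(n(u := Suc (n v)))(v := Suc (n v)) = (n(w := Suc (n w)))(u := (n(w := Suc (n w))) v)"
      "(d(u := x))(v := x) = (d(w := x))(u := (d(w := x)) v)"
      using True assms(4) by (simp_all add: fun_upd_twist)
    ultimately show ?thesis by (simp only:)
  next
    case False
    have "(d(u := d v)) z \<noteq> x" if "z \<in> S" "E z w" for z
      using step.hyps that assms(2,4) dominated[of w] sym by (cases "z = u") auto
    then have "recolors S L (c(u := c v)) ((n(u := n v))(w := Suc ((n(u := n v)) w))) ((d(u := d v))(w := x))"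
      by (intro recolors.step[OF step.IH]) (use step.hyps in blast)+
    then have "recolors S L (c(u := c v)) ((n(u := n v))(w := Suc (n w))) ((d(u := d v))(w := x))"
      using step.hyps by simp
    moreover have "(n(u := n v))(w := Suc (n w)) = (n(w := Suc (n w)))(u := (n(w := Suc (n w))) v)"
      "(d(u := d v))(w := x) = (d(w := x))(u := (d(w := x)) v)"
      using False step.hyps by (auto simp: fun_eq_iff)
    ultimately show ?thesis by (simp only:)
  qed
qed

text \<open>The two extra moves are those of \<open>u\<close> to the color of \<open>v\<close> at
  the start and from the color of \<open>v\<close> to \<open>d u\<close> at the end; in between
  \<open>u\<close> imitates \<open>v\<close>. The target \<open>d(u := c u)\<close> reflects that
  \<open>u\<close> stands still while it is deleted.\<close>

lemma reaches_dominated: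
  assumes c: "proper S L c" and d: "proper S L d"
    and uv: "v \<in> S" "u \<in> S" "u \<noteq> v" and dominated: "\<And>w. w \<in> S \<Longrightarrow> E w u \<Longrightarrow> E w v"
    and reach: "reaches (S - {u}) L k c (d(u := c u))"
  shows "reaches S L (k + 2) c d"
proof -
  obtain n where n: "recolors (S - {u}) L c n (d(u := c u))" "\<And>v. n v \<le> k"
    using reach unfolding reaches_def by blast
  have r: "recolors S L (c(u := c v)) (n(u := n v)) (d(u := d v))"
    using recolors_duplicate[OF n(1) uv dominated] uv by simp
  have "reaches S L k (c(u := c v)) (d(u := d v))"
    unfolding reaches_def using r n(2) by (intro exI[of _ "n(u := n v)"]) auto
  moreover have "recolors S L c (\<lambda>w. if w = u then 1 else 0) (c(u := c v))"
    using c uv dominated by (intro recolors_single) (auto simp: proper_def)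
  then have "reaches S L 1 c (c(u := c v))" unfolding reaches_def by force
  moreover have "recolors S L d (\<lambda>w. if w = u then 1 else 0) (d(u := d v))"
    using d uv dominated by (intro recolors_single) (auto simp: proper_def)
  then have "reaches S L 1 d (d(u := d v))" unfolding reaches_def by force
  then have "reaches S L 1 (d(u := d v)) d" using reaches_sym d by blast
  ultimately have "reaches S L (1 + k + 1) c d" by (blast intro: reaches_trans)
  then show ?thesis by simp
qed

subsection \<open>Permuting the colors\<close>

definition same_classes :: "'a set \<Rightarrow> ('a \<Rightarrow> nat) \<Rightarrow> ('a \<Rightarrow> nat) \<Rightarrow> bool" where
  "same_classes S c d \<longleftrightarrow> (\<forall>u\<in>S. \<forall>v\<in>S. c u = c v \<longleftrightarrow> d u = d v)"

lemma same_classes_card: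
  assumes "same_classes S c d"
  shows "card (c ` S) = card (d ` S)"
proof -
  let ?h = "\<lambda>x. d (SOME v. v \<in> S \<and> c v = x)"
  have h: "?h (c v) = d v" if "v \<in> S" for v
    using someI[of "\<lambda>w. w \<in> S \<and> c w = c v" v] that assms unfolding same_classes_def by blast
  have "bij_betw ?h (c ` S) (d ` S)"
    unfolding bij_betw_def inj_on_def
    using h assms unfolding same_classes_def by (auto simp: image_image)
  then show ?thesis by (rule bij_betw_same_card)
qed

text \<open>Moving one class to an unused color turns a cyclic permutation of the colors into a chain
  of moves to free colors; the moved class then has the color \<open>z\<close> of the assumption \<open>chain\<close>.\<close>

lemma recolors_same_classes_of_chain:
  assumes fin: "finite S" "finite L" and c: "proper S L c"
    and outside: "\<And>v. v \<notin> S \<Longrightarrow> c v = d v" and same: "same_classes S c d"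
    and less: "card (c ` S) < card L"
    and chain: "\<And>c z. proper S L c \<Longrightarrow> (\<And>v. v \<notin> S \<Longrightarrow> c v = d v) \<Longrightarrow> same_classes S c d
      \<Longrightarrow> z \<in> c ` S - d ` S \<Longrightarrow> \<exists>n. recolors S L c n d \<and> (\<forall>v. n v \<le> (if c v = z then 1 else 2))"
  shows "\<exists>n. recolors S L c n d \<and> (\<forall>v. n v \<le> 2)"
proof (cases "c ` S = d ` S")
  case False
  then have "\<not> c ` S \<subseteq> d ` S"
    using same_classes_card[OF same] fin(1) by (metis card_subset_eq finite_imageI)
  then obtain z where "z \<in> c ` S - d ` S" by blast
  from chain[OF c outside same this] obtain n
    where "recolors S L c n d" "\<forall>v. n v \<le> (if c v = z then 1 else 2)"
    by blast
  moreover have "(if P then 1 else 2) \<le> (2 :: nat)" for P by simp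
  ultimately show ?thesis using le_trans by blast
next
  case True
  show ?thesis
  proof (cases "S = {}")
    case empty: True
    then have "c = d" using outside by auto
    then show ?thesis using recolors.refl[of S L c] by (intro exI[of _ "\<lambda>_. 0"]) simp
  next
    case False
    then obtain s where s: "s \<in> S" by blast
    have "\<not> L \<subseteq> c ` S"
      using less fin(1) by (metis card_mono finite_imageI leD)
    then obtain f where f: "f \<in> L" "f \<notin> c ` S" by blast
    define c' where "c' = (\<lambda>v. if v \<in> S \<and> c v = c s then f else c v)"
    have fne: "c v \<noteq> f" if "v \<in> S" for v using f that by blast
    have c': "proper S L c'"
      using c f fne unfolding proper_def c'_def by (auto; metis)
    have "same_classes S c' d"
      using same fne unfolding same_classes_def c'_def by (auto; metis)
    moreover have "f \<in> c' ` S - d ` S"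
      using s f True by (auto simp: c'_def)
    ultimately obtain n where n: "recolors S L c' n d" "\<And>v. n v \<le> (if c' v = f then 1 else 2)"
      using chain[OF c', of f] outside unfolding c'_def by auto
    have "recolors S L c (\<lambda>v. if c v = c' v then 0 else 1) c'"
    proof (rule recolors_compatible[OF fin(1) c c'])
      fix u v assume "u \<in> S" "v \<in> S" "E u v"
      then show "c u \<noteq> c' v" using c fne[of u] unfolding proper_def c'_def by auto
    qed (auto simp: c'_def)
    then have "recolors S L c (\<lambda>v. (if c v = c' v then 0 else 1) + n v) d"
      using n(1) recolors_trans by blast
    \<comment> \<open>The class of \<open>s\<close> spends one move on reaching \<open>f\<close>,
      and \<open>chain\<close> with \<open>f\<close> as \<open>z\<close> grants it only one more.
      The other classes have not moved yet.\<close>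
    moreover have "(if c v = c' v then 0 else 1) + n v \<le> 2" for v
      using n(2)[of v] by (cases "v \<in> S \<and> c v = c s") (auto simp: c'_def split: if_splits)
    ultimately show ?thesis by blast
  qed
qed

text \<open>Both colorings use equally many colors and \<open>z\<close> is used by \<open>c\<close>
  only, so some target color \<open>d x\<close> is still free. The class \<open>X\<close> of
  \<open>x\<close> moves there for good, and \<open>X\<close> and \<open>d x\<close> drop out of the
  problem.\<close>

lemma recolors_same_classes_chain:
  assumes "finite S" "finite L" "proper S L c" "proper S L d"
    and "\<And>v. v \<notin> S \<Longrightarrow> c v = d v" "same_classes S c d" "z \<in> c ` S - d ` S"
  shows "\<exists>n. recolors S L c n d \<and> (\<forall>v. n v \<le> (if c v = z then 1 else 2))"
  using assms
proof (induction "card S" arbitrary: S L c z rule: less_induct)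
  case less
  note c = less.prems(3) and d = less.prems(4) and outside = less.prems(5)
    and same = less.prems(6) and z = less.prems(7)
  have "\<not> d ` S \<subseteq> c ` S"
    using same_classes_card[OF same] z less.prems(1) by (metis DiffE card_subset_eq finite_imageI)
  then obtain x where x: "x \<in> S" "d x \<notin> c ` S" by blast
  define X where "X = {v \<in> S. d v = d x}"
  define c' where "c' = (\<lambda>v. if v \<in> X then d v else c v)"
  let ?S = "S - X" and ?L = "L - {d x}"
  have X: "v \<in> X \<longleftrightarrow> v \<in> S \<and> c v = c x" for v
    using x same unfolding X_def same_classes_def by blast
  have xne: "c v \<noteq> d x" if "v \<in> S" for v using x that by (metis imageI)
  have c': "proper S L c'"
    using c d xne unfolding proper_def c'_def X_def by (auto; metis)
  have cc': "recolors S L c (\<lambda>v. if c v = c' v then 0 else 1) c'"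
  proof (rule recolors_compatible[OF less.prems(1) c c'])
    fix u v assume "u \<in> S" "v \<in> S" "E u v"
    then show "c u \<noteq> c' v" using c xne[of u] unfolding proper_def c'_def X_def by auto
  qed (auto simp: c'_def X_def)
  have smaller: "card ?S < card S"
    using x less.prems(1) by (intro psubset_card_mono) (auto simp: X_def)
  have sub: "finite ?S" "finite ?L" "proper ?S ?L c'" "proper ?S ?L d"
    "\<And>v. v \<notin> ?S \<Longrightarrow> c' v = d v" "same_classes ?S c' d"
    using less.prems(1,2) c d xne outside same
    unfolding proper_def c'_def X_def same_classes_def by auto
  have IH: "\<exists>n. recolors ?S ?L e n d \<and> (\<forall>v. n v \<le> (if e v = y then 1 else 2))"
    if "proper ?S ?L e" "\<And>v. v \<notin> ?S \<Longrightarrow> e v = d v" "same_classes ?S e d" "y \<in> e ` ?S - d ` ?S" for e y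
    using less.hyps[OF smaller sub(1,2) that(1) sub(4) that(2-4)] .
  have "\<exists>n. recolors ?S ?L c' n d \<and> (\<forall>v. v \<notin> X \<longrightarrow> n v \<le> (if c v = z then 1 else 2))"
  proof (cases "c x = z")
    case True
    \<comment> \<open>If \<open>X\<close> was the class colored \<open>z\<close>, its move releases
      \<open>z\<close>. This is the spare color that allows the remaining classes to be permuted
      arbitrarily with two moves each.\<close>
    have "c' ` ?S \<subset> ?L"
    proof
      show "c' ` ?S \<subseteq> ?L" using sub(3) unfolding proper_def by auto
      have "z \<in> ?L" using True x z c xne[of x] unfolding proper_def by auto
      moreover have "z \<notin> c' ` ?S"
      proof
        assume "z \<in> c' ` ?S"
        then obtain v where v: "v \<in> S" "v \<notin> X" "z = c' v" by blast
        then have "c v = c x" using True by (simp only: c'_def if_False)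
        then show False using X[of v] v by blast
      qed
      ultimately show "c' ` ?S \<noteq> ?L" by blast
    qed
    then have "card (c' ` ?S) < card ?L" by (rule psubset_card_mono[OF sub(2)])
    from recolors_same_classes_of_chain[OF sub(1-3,5,6) this IH]
    obtain n where n: "recolors ?S ?L c' n d" "\<forall>v. n v \<le> 2" by blast
    have "n v \<le> (if c v = z then 1 else 2)" if "v \<notin> X" for v
    proof (cases "v \<in> S")
      case True
      then have "c v \<noteq> z" using X[of v] \<open>v \<notin> X\<close> \<open>c x = z\<close> by metis
      then show ?thesis using n(2) by simp
    next
      case False
      then have "n v = 0" using recolors_outside(2)[OF n(1)] by blast
      then show ?thesis by simp
    qed
    then show ?thesis using n(1) by blast
  next
    case False
    \<comment> \<open>Otherwise \<open>z\<close> is still a color of the smaller problem that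
      \<open>d\<close> does not use, and the induction hypothesis applies with the same
      \<open>z\<close>.\<close>
    obtain w where w: "w \<in> S" "z = c w" "z \<notin> d ` S" using z by blast
    then have "w \<in> ?S" "c' w = z" using X[of w] False unfolding c'_def by auto
    then have "z \<in> c' ` ?S - d ` ?S" using w(3) by blast
    from IH[OF sub(3,5,6) this] obtain n
      where n: "recolors ?S ?L c' n d" "\<And>v. n v \<le> (if c' v = z then 1 else 2)" by blast
    have "n v \<le> (if c v = z then 1 else 2)" if "v \<notin> X" for v
      using n(2)[of v] that by (simp add: c'_def)
    then show ?thesis using n(1) by blast
  qed
  then obtain n where n: "recolors ?S ?L c' n d"
    "\<And>v. v \<notin> X \<Longrightarrow> n v \<le> (if c v = z then 1 else 2)" by blast
  have "recolors S L c' n d"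
    by (rule recolors_mono[OF n(1)]) (auto simp: c'_def X_def)
  then have "recolors S L c (\<lambda>v. (if c v = c' v then 0 else 1) + n v) d"
    using cc' recolors_trans by blast
  moreover have "(if c v = c' v then 0 else 1) + n v \<le> (if c v = z then 1 else 2)" for v
    using n(2)[of v] recolors_outside(2)[OF n(1), of v] by (cases "v \<in> X") (auto simp: c'_def)
  ultimately show ?case by blast
qed

lemma reaches_same_classes:
  assumes "finite S" "finite L" "proper S L c" "proper S L d"
    and "\<And>v. v \<notin> S \<Longrightarrow> c v = d v" "same_classes S c d" "card (c ` S) < card L"
  shows "reaches S L 2 c d"
  unfolding reaches_def
  using recolors_same_classes_of_chain[OF assms(1-3,5-7)]
    recolors_same_classes_chain[OF assms(1,2) _ assms(4)] by blast

end

section \<open>Graphs without dominated vertices\<close>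

locale undominated_graph = simple_graph E for E :: "'a \<Rightarrow> 'a \<Rightarrow> bool" +
  fixes S :: "'a set" and L :: "nat set"
  assumes finite_S: "finite S" and finite_L: "finite L"
    and two_K2: "\<lbrakk>u \<in> S; v \<in> S; x \<in> S; y \<in> S; E u v; E x y\<rbrakk> \<Longrightarrow> E u x \<or> E u y \<or> E v x \<or> E v y"
    and diamond: "\<lbrakk>u \<in> S; v \<in> S; x \<in> S; y \<in> S; E u v; E x u; E x v; E y u; E y v; x \<noteq> y\<rbrakk> \<Longrightarrow> E x y"
    and undominated: "\<lbrakk>u \<in> S; v \<in> S; u \<noteq> v\<rbrakk> \<Longrightarrow> \<exists>w\<in>S. E w u \<and> \<not> E w v"
    and colorable: "\<exists>M h. finite M \<and> card M < card L \<and> proper S M h"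
begin

text \<open>The coloring in \<open>colorable\<close> is unknown, so a lower bound on the palette
  comes from differently colored vertices that every proper coloring must exhibit.\<close>

lemma rainbow_card_less:
  assumes "\<And>h M. proper S M h \<Longrightarrow> \<exists>U\<subseteq>S. card U = k \<and> inj_on h U"
  shows "k < card L"
proof -
  obtain M h where M: "finite M" "card M < card L" "proper S M h" using colorable by blast
  obtain U where U: "U \<subseteq> S" "card U = k" "inj_on h U" using assms[OF M(3)] by blast
  have "h ` U \<subseteq> M" using U(1) M(3) unfolding proper_def by auto
  then have "k \<le> card M" using U(2,3) card_image card_mono M(1) by metis
  then show ?thesis using M(2) by simp
qed

lemma clique_card_less:
  assumes "K \<subseteq> S" "\<And>u v. u \<in> K \<Longrightarrow> v \<in> K \<Longrightarrow> u \<noteq> v \<Longrightarrow> E u v"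
  shows "card K < card L"
proof (rule rainbow_card_less)
  fix h M assume "proper S M h"
  then have "inj_on h K" using assms unfolding proper_def inj_on_def by blast
  then show "\<exists>U\<subseteq>S. card U = card K \<and> inj_on h U" using assms(1) by blast
qed

text \<open>All color classes are singletons, so only the colors have to be permuted.\<close>

lemma reaches_complete:
  assumes complete: "\<And>u v. u \<in> S \<Longrightarrow> v \<in> S \<Longrightarrow> u \<noteq> v \<Longrightarrow> E u v"
    and cd: "proper S L c" "proper S L d" "\<And>v. v \<notin> S \<Longrightarrow> c v = d v"
  shows "reaches S L (2 * card S) c d"
proof (cases "S = {}")
  case True
  then have "c = d" using cd(3) by auto
  then show ?thesis by (simp add: reaches_refl)
next
  case False
  have "same_classes S c d"
    using complete cd(1,2) unfolding same_classes_def proper_def by metis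
  moreover have "card (c ` S) < card L"
    using clique_card_less[of S] complete card_image_le[OF finite_S, of c] by fastforce
  ultimately have "reaches S L 2 c d"
    using reaches_same_classes finite_S finite_L cd by blast
  moreover have "card S \<noteq> 0" using False finite_S by simp
  ultimately show ?thesis by (auto intro: reaches_le)
qed

end

locale maximal_clique_graph = undominated_graph +
  fixes K :: "'a set"
  assumes K_subset: "K \<subseteq> S"
    and K_clique: "\<lbrakk>u \<in> K; v \<in> K; u \<noteq> v\<rbrakk> \<Longrightarrow> E u v"
    and K_maximal: "v \<in> S - K \<Longrightarrow> \<exists>k\<in>K. \<not> E v k"
begin

lemma finite_K: "finite K"
  using K_subset finite_S finite_subset by blast

text \<open>By maximality \<open>v\<close> misses some \<open>k\<close> in \<open>K\<close>; then
  \<open>v\<close> and \<open>k\<close> would complete the edge \<open>x y\<close> to a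
  diamond.\<close>

lemma neighbor_in_K_unique:
  assumes "v \<in> S - K" "x \<in> K" "y \<in> K" "E v x" "E v y"
  shows "x = y"
proof (rule ccontr)
  assume "x \<noteq> y"
  obtain k where k: "k \<in> K" "\<not> E v k" using K_maximal assms(1) by blast
  then have "E v k"
    using assms diamond[of x y v k] K_clique[of x y] K_clique[of k] K_subset \<open>x \<noteq> y\<close> by blast
  then show False using k by blast
qed

lemma card_neighbors_in_K:
  assumes "v \<in> S - K"
  shows "card {x\<in>K. E v x} \<le> 1"
  using neighbor_in_K_unique[OF assms] finite_K by (simp add: card_le_Suc0_iff_eq)

text \<open>Two vertices of the clique missed by both \<open>u\<close> and \<open>v\<close> would
  form an edge without connection to the edge \<open>u v\<close>.\<close>

lemma adjacent_outside_K:
  assumes "u \<in> S - K" "v \<in> S - K" "E u v"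
  shows "card (K - {x\<in>K. E u x} - {x\<in>K. E v x}) \<le> 1"
proof -
  have "x = y" if "x \<in> K - {x\<in>K. E u x} - {x\<in>K. E v x}" "y \<in> K - {x\<in>K. E u x} - {x\<in>K. E v x}" for x y
    using that assms two_K2[of u v x y] K_clique[of x y] K_subset by blast
  then show ?thesis using finite_K by (simp add: card_le_Suc0_iff_eq)
qed

lemma card_K_adjacent_outside:
  assumes "u \<in> S - K" "v \<in> S - K" "E u v"
  shows "card K \<le> card {x\<in>K. E u x} + card {x\<in>K. E v x} + 1"
proof -
  have "card K \<le> card (K - {x\<in>K. E u x}) + card {x\<in>K. E u x}"
    using diff_card_le_card_Diff[of "{x\<in>K. E u x}" K] finite_K by simp
  moreover have "card (K - {x\<in>K. E u x})
      \<le> card (K - {x\<in>K. E u x} - {x\<in>K. E v x}) + card {x\<in>K. E v x}"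
    using diff_card_le_card_Diff[of "{x\<in>K. E v x}" "K - {x\<in>K. E u x}"] finite_K by simp
  ultimately show ?thesis using adjacent_outside_K[OF assms] by linarith
qed

text \<open>The ends of an outer edge see at most one vertex of \<open>K\<close> each and together
  miss at most one, which leaves room for only three. Hence the outer vertices are independent, all
  neighbors of an outer vertex lie in \<open>K\<close>, and any vertex of \<open>K\<close> not
  adjacent to it dominates it.\<close>

lemma eq_K_if_card_ge_4:
  assumes "card K \<ge> 4"
  shows "S = K"
proof (rule ccontr)
  assume "S \<noteq> K"
  then obtain v where v: "v \<in> S - K" using K_subset by blast
  have ind: "\<not> E u v" if "u \<in> S - K" for u
    using card_K_adjacent_outside[OF that v] card_neighbors_in_K[OF that] card_neighbors_in_K[OF v] assms
    by linarith
  have "\<not> card K \<le> Suc 0" using assms by simp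
  then obtain k where k: "k \<in> K" "\<forall>x\<in>K. E v x \<longrightarrow> x \<noteq> k"
    using neighbor_in_K_unique[OF v] finite_K by (metis card_le_Suc0_iff_eq)
  then obtain w where "w \<in> S" "E w v" "\<not> E w k"
    using undominated[of v k] v K_subset by blast
  then show False using ind[of w] k K_clique[of w k] sym[of w v] by blast
qed

end

section \<open>A maximal triangle\<close>

locale maximal_triangle_graph = maximal_clique_graph +
  assumes card_K: "card K = 3"
begin

section \<open>The unique triangle neighbor of an outer vertex\<close>

definition foot :: "'a \<Rightarrow> 'a" where
  "foot v = (THE x. x \<in> K \<and> E v x)"

text \<open>A vertex without neighbors in the triangle still has some neighbor \<open>w\<close>, for
  otherwise it would be dominated. The edge from \<open>w\<close> to \<open>v\<close> then sees at
  most one triangle vertex but may miss only one of the three.\<close>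

lemma foot:
  assumes v: "v \<in> S - K"
  shows "foot v \<in> K" "E v (foot v)"
proof -
  have "{x\<in>K. E v x} \<noteq> {}"
  proof
    assume none: "{x\<in>K. E v x} = {}"
    obtain k where "k \<in> K" using card_K by fastforce
    then obtain w where w: "w \<in> S" "E w v" using undominated[of v k] v K_subset by blast
    then have "w \<in> S - K" using none sym by blast
    from card_K_adjacent_outside[OF this v w(2)] card_neighbors_in_K[OF this] none card_K
    show False by simp
  qed
  then have "\<exists>!x. x \<in> K \<and> E v x" using neighbor_in_K_unique[OF v] by blast
  then have "foot v \<in> K \<and> E v (foot v)" unfolding foot_def by (rule theI')
  then show "foot v \<in> K" "E v (foot v)" by auto
qed

lemma foot_iff: "v \<in> S - K \<Longrightarrow> x \<in> K \<Longrightarrow> E v x \<longleftrightarrow> x = foot v"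
  using foot neighbor_in_K_unique by blast

text \<open>An edge between vertices with a common foot would miss two triangle vertices. In
  particular, the vertices with a given foot are independent.\<close>

lemma foot_adjacent:
  assumes "u \<in> S - K" "v \<in> S - K" "E u v"
  shows "foot u \<noteq> foot v"
proof
  assume eq: "foot u = foot v"
  have "{x\<in>K. E u x} = {foot u}" "{x\<in>K. E v x} = {foot u}"
    using foot_iff assms eq foot by auto
  then have "card (K - {foot u}) \<le> 1" using adjacent_outside_K[OF assms] by simp
  then show False using card_K foot[OF assms(1)] finite_K by simp
qed

lemma K_eq:
  assumes "x \<in> K" "y \<in> K" "z \<in> K" "x \<noteq> y" "x \<noteq> z" "y \<noteq> z"
  shows "K = {x, y, z}"
  using assms card_K finite_K by (intro card_subset_eq[symmetric]) auto

lemma ex_third: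
  assumes "x \<in> K" "y \<in> K"
  shows "\<exists>z\<in>K. z \<noteq> x \<and> z \<noteq> y"
proof (rule ccontr)
  assume "\<not> ?thesis"
  then have "K \<subseteq> {x, y}" by blast
  then have "card K \<le> card {x, y}" by (intro card_mono) auto
  then show False using card_K card_insert_le_m1[of 2 "{y}" x] by simp
qed

text \<open>Take a neighbor of \<open>v\<close> that misses the third triangle vertex
  \<open>y\<close>. Its foot is not \<open>y\<close>, and by \<open>foot_adjacent\<close> it is not
  the foot of \<open>v\<close>.\<close>

lemma ex_neighbor_with_foot:
  assumes v: "v \<in> S - K" and x: "x \<in> K" "x \<noteq> foot v"
  shows "\<exists>u\<in>S - K. E u v \<and> foot u = x"
proof -
  obtain y where y: "y \<in> K" "y \<noteq> x" "y \<noteq> foot v" using ex_third x(1) foot[OF v] by blast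
  obtain w where w: "w \<in> S" "E w v" "\<not> E w y"
    using undominated[of v y] v y(1) K_subset by blast
  have "w \<notin> K"
  proof
    assume "w \<in> K"
    then have "w = foot v" using foot_iff v w sym by blast
    then show False using K_clique[of w y] y w \<open>w \<in> K\<close> by blast
  qed
  moreover have "K = {x, y, foot v}" using K_eq x y foot[OF v] by blast
  ultimately show ?thesis
    using w foot[of w] foot_iff[of w y] y foot_adjacent[of w v] v by blast
qed

text \<open>This excludes that \<open>w\<close> is blocked twice, along \<open>w\<close>,
  \<open>u\<close>, \<open>v'\<close> and along \<open>w\<close>, \<open>v\<close>,
  \<open>u'\<close>. Vertices with equal feet are independent, so without the edge
  \<open>u' v'\<close> each pair of edges has just one way to avoid a \<open>2K_2\<close>. The edges
  forced in this way end in a diamond.\<close>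

lemma no_blocked_vertex:
  assumes S: "u \<in> S - K" "u' \<in> S - K" "v \<in> S - K" "v' \<in> S - K" "w \<in> S - K"
    and foots: "foot u = x" "foot u' = x" "foot v = y" "foot v' = y" "foot w = z"
    and distinct: "x \<noteq> y" "x \<noteq> z" "y \<noteq> z"
    and E: "E w u" "E w v" "E u v'" "E u' v"
  shows "E u' v'"
proof (rule ccontr)
  assume non: "\<not> E u' v'"
  have same: "\<not> E s t" if "s \<in> S - K" "t \<in> S - K" "foot s = foot t" for s t
    using foot_adjacent that by blast
  have in_S: "u \<in> S" "u' \<in> S" "v \<in> S" "v' \<in> S" "w \<in> S" using S by blast+
  have non': "\<not> E v' u'" using non sym by blast
  have uu': "\<not> E u u'" "\<not> E u' u" and vv': "\<not> E v v'" "\<not> E v' v"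
    using same S foots by simp_all
  have "u \<noteq> u'" "v \<noteq> v'" using E non by blast+
  have uv: "E u v" using two_K2[OF in_S(1,4,2,3) E(3,4)] uu' vv' non' by blast
  have wv': "\<not> E w v'"
    using diamond[OF in_S(1,5,3,4) sym[OF E(1)] sym[OF uv] sym[OF E(2)] sym[OF E(3)]] \<open>v \<noteq> v'\<close> vv' sym
    by blast
  have wu': "\<not> E w u'"
    using diamond[OF in_S(3,5,1,2) sym[OF E(2)] uv sym[OF E(1)] E(4)] \<open>u \<noteq> u'\<close> uu' sym by blast
  \<comment> \<open>A second vertex with foot \<open>z\<close>; it differs from \<open>w\<close>
    because \<open>w\<close> is not adjacent to \<open>u'\<close>.\<close>
  obtain w' where w': "w' \<in> S - K" "E w' u'" "foot w' = z"
    using ex_neighbor_with_foot[OF S(2), of z] foot(1)[OF S(5)] foots distinct by auto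
  have w'S: "w' \<in> S" using w' by blast
  have ww': "\<not> E w w'" "\<not> E w' w" "w \<noteq> w'" using same[OF S(5) w'(1)] same[OF w'(1) S(5)] w'(2,3) foots wu' by auto
  have w'u: "E w' u"
    using two_K2[OF w'S in_S(2,5,1) w'(2) E(1)] ww' uu' wu' sym by blast
  have y: "y \<in> K" "E y v'" "\<not> E y u'" "\<not> E y w'"
    using foot[OF S(4)] foot_iff[OF S(2), of y] foot_iff[OF w'(1), of y] foots distinct w'(3) sym by auto
  have yS: "y \<in> S" using y K_subset by blast
  have w'v': "E w' v'"
    using two_K2[OF w'S in_S(2) yS in_S(4) w'(2) y(2)] y(3,4) non sym by blast
  have "E w' v"
    using two_K2[OF w'S in_S(4,5,3) w'v' E(2)] ww' vv' wv' sym by blast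
  \<comment> \<open>The edge \<open>u v\<close> has both \<open>w\<close> and \<open>w'\<close> as
    common neighbors, though these share the foot \<open>z\<close>.\<close>
  then have "E w w'"
    using diamond[OF in_S(1,3,5) w'S uv E(1,2) w'u] ww' by blast
  then show False using ww' by blast
qed

text \<open>The aim is to give \<open>w\<close> the color of \<open>y\<close>. Among the neighbors
  of \<open>w\<close>, only those with foot \<open>x\<close> can carry this color, as those with
  foot \<open>y\<close> are adjacent to \<open>y\<close> itself. They step aside to the color of
  \<open>foot w\<close>. Since they exchange one triangle color for another, \<open>w\<close> is the
  only vertex that leaves the set of unsettled ones.\<close>

lemma recolor_unblocked:
  assumes f: "proper S L f" and w: "w \<in> S - K" "f w \<notin> f ` K"
    and xy: "x \<in> K" "y \<in> K" "x \<noteq> y" "x \<noteq> foot w" "y \<noteq> foot w"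
    and unblocked: "\<And>u v. u \<in> S - K \<Longrightarrow> foot u = x \<Longrightarrow> E w u \<Longrightarrow> f u = f y
      \<Longrightarrow> v \<in> S \<Longrightarrow> E u v \<Longrightarrow> f v \<noteq> f (foot w)"
  shows "\<exists>g. reaches S L 1 f g \<and> (\<forall>v\<in>K. g v = f v)
    \<and> {v\<in>S - K. g v \<notin> f ` K} = {v\<in>S - K. f v \<notin> f ` K} - {w}"
proof -
  define U where "U = {u\<in>S - K. foot u = x \<and> E w u \<and> f u = f y}"
  define f' where "f' = (\<lambda>v. if v \<in> U then f (foot w) else f v)"
  define g where "g = f'(w := f y)"
  have footw: "foot w \<in> K" "foot w \<in> S" using foot[OF w(1)] K_subset by blast+
  have K: "K = {x, y, foot w}" using K_eq xy footw(1) by blast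
  have ne: "f s \<noteq> f t" if "s \<in> S" "t \<in> S" "E s t" for s t
    using f that unfolding proper_def by blast
  have inL: "f s \<in> L" if "s \<in> S" for s using f that unfolding proper_def by blast
  have Kne: "f s \<noteq> f t" if "s \<in> K" "t \<in> K" "s \<noteq> t" for s t
    using ne[of s t] K_clique[of s t] K_subset that by blast
  have U: "u \<in> S" "u \<notin> K" "foot u = x" "f u = f y" if "u \<in> U" for u
    using that unfolding U_def by blast+
  have Ufree: "f v \<noteq> f (foot w)" if "u \<in> U" "v \<in> S" "E u v" for u v
    using unblocked[of u v] that unfolding U_def by blast
  have Uindep: "\<not> E u v" if "u \<in> U" "v \<in> U" for u v
    using foot_adjacent[of u v] U[OF that(1)] U[OF that(2)] by auto
  have wU: "w \<notin> U" using xy(4) U(3)[of w] by blast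
  have "recolors S L f (\<lambda>v. if f v = (if v \<in> U then f (foot w) else f v) then 0 else 1)
      (\<lambda>v. if v \<in> U then f (foot w) else f v)"
    by (rule recolors_set(2)[OF finite_S f]) (use U inL footw Uindep Ufree sym in blast)+
  then have 1: "recolors S L f (\<lambda>v. if f v = f' v then 0 else 1) f'" unfolding f'_def .
  have 2: "recolors S L f' (\<lambda>v. if v = w then 1 else 0) g"
    unfolding g_def
  proof (rule recolors_single)
    fix u assume u: "u \<in> S" "E u w"
    show "f' u \<noteq> f y"
    proof (cases "u \<in> K")
      case True
      then have "u = foot w" using foot_iff[OF w(1) True] sym[OF u(2)] by blast
      then show ?thesis using Kne[of u y] xy True U(2)[of u] unfolding f'_def by auto
    next
      case False
      then have uSK: "u \<in> S - K" using u by blast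
      then have "foot u = x \<or> foot u = y" using foot_adjacent[OF uSK w(1) u(2)] foot(1)[OF uSK] K by blast
      then show ?thesis
      proof
        assume "foot u = x"
        then have "u \<in> U \<or> f u \<noteq> f y" using uSK sym[OF u(2)] unfolding U_def by blast
        then show ?thesis using Kne[of "foot w" y] xy footw(1) unfolding f'_def by auto
      next
        assume "foot u = y"
        then have "f u \<noteq> f y" using ne[of u y] foot(2)[OF uSK] uSK xy(2) K_subset by auto
        moreover have "u \<notin> U" using U(3)[of u] \<open>foot u = y\<close> xy(3) by blast
        ultimately show ?thesis unfolding f'_def by simp
      qed
    qed
  qed (use w xy K_subset inL in auto)
  have "recolors S L f (\<lambda>v. (if f v = f' v then 0 else 1) + (if v = w then 1 else 0)) g"
    using recolors_trans[OF 2 1] .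
  then have "reaches S L 1 f g"
    unfolding reaches_def using wU by (intro exI conjI allI) (auto simp: f'_def)
  moreover have "\<forall>v\<in>K. g v = f v"
    using U(2) w(1) unfolding g_def f'_def by auto
  moreover have "(g v \<notin> f ` K) = (f v \<notin> f ` K \<and> v \<noteq> w)" for v
    using U(4)[of v] xy(2) footw(1) unfolding g_def f'_def by auto
  ultimately show ?thesis by blast
qed

text \<open>Either of the triangle vertices \<open>x\<close> and \<open>y\<close> offers its color
  to \<open>w\<close>. If both attempts fail, the obstructing vertices \<open>v'\<close> and
  \<open>u'\<close> have the same color \<open>f (foot w)\<close>, yet
  \<open>no_blocked_vertex\<close> makes them adjacent.\<close>

lemma recolor_one:
  assumes f: "proper S L f" and w: "w \<in> S - K" "f w \<notin> f ` K"
  shows "\<exists>g. reaches S L 1 f g \<and> (\<forall>v\<in>K. g v = f v)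
    \<and> {v\<in>S - K. g v \<notin> f ` K} = {v\<in>S - K. f v \<notin> f ` K} - {w}"
proof (rule ccontr)
  assume stuck: "\<not> ?thesis"
  have z: "foot w \<in> K" using foot[OF w(1)] by blast
  obtain x where x: "x \<in> K" "x \<noteq> foot w" using ex_third[OF z z] by blast
  obtain y where y: "y \<in> K" "y \<noteq> x" "y \<noteq> foot w" using ex_third[OF x(1) z] by blast
  have K: "K = {x, y, foot w}" using K_eq x y z by blast
  have ne: "f s \<noteq> f t" if "s \<in> S" "t \<in> S" "E s t" for s t
    using f that unfolding proper_def by blast
  have Kne: "f s \<noteq> f t" if "s \<in> K" "t \<in> K" "s \<noteq> t" for s t
    using ne[of s t] K_clique[of s t] K_subset that by blast
  have foot_ne: "f v \<noteq> f (foot v)" if "v \<in> S - K" for v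
    using ne[of v "foot v"] foot[OF that] K_subset that by blast
  have blocked: "\<exists>u v. u \<in> S - K \<and> foot u = x \<and> E w u \<and> v \<in> S - K \<and> foot v = y \<and> E u v \<and> f v = f (foot w)"
    if xy: "x \<in> K" "y \<in> K" "x \<noteq> y" "x \<noteq> foot w" "y \<noteq> foot w" "K = {x, y, foot w}" for x y
  proof -
    obtain u v where uv: "u \<in> S - K" "foot u = x" "E w u" "f u = f y" "v \<in> S" "E u v" "f v = f (foot w)"
      using recolor_unblocked[OF f w xy(1-5)] stuck by blast
    have "v \<notin> K"
    proof
      assume "v \<in> K"
      then have "v = x" using foot_iff[OF uv(1)] uv(2,6) by blast
      then show False using Kne[of x "foot w"] uv(7) xy(1,4) z by blast
    qed
    then have v: "v \<in> S - K" using uv(5) by blast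
    have "foot v \<noteq> foot w" using foot_ne[OF v] uv(7) by metis
    moreover have "foot v \<noteq> x" using foot_adjacent[OF uv(1) v uv(6)] uv(2) by blast
    ultimately have "foot v = y" using foot(1)[OF v] xy(6) by blast
    then show ?thesis using uv v by blast
  qed
  obtain u v' where u: "u \<in> S - K" "foot u = x" "E w u" "v' \<in> S - K" "foot v' = y" "E u v'" "f v' = f (foot w)"
    using blocked[of x y] x y K by blast
  have "K = {y, x, foot w}" using K by blast
  then obtain v u' where v: "v \<in> S - K" "foot v = y" "E w v" "u' \<in> S - K" "foot u' = x" "E v u'" "f u' = f (foot w)"
    using blocked[of y x] x y by blast
  have "E u' v'"
    using no_blocked_vertex[OF u(1) v(4) v(1) u(4) w(1) u(2) v(5) v(2) u(5) HOL.refl] x y u(3,6) v(3) sym[OF v(6)]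
    by blast
  then show False using ne[of u' v'] u(4,7) v(4,7) by auto
qed

text \<open>A round settles one vertex and moves every vertex at most once, so the number of
  unsettled vertices bounds the moves at each vertex.\<close>

lemma reaches_colors_of_K:
  assumes "proper S L f"
  shows "\<exists>g. reaches S L (card {v\<in>S - K. f v \<notin> f ` K}) f g \<and> (\<forall>v\<in>S - K. g v \<in> g ` K)"
  using assms
proof (induction "card {v\<in>S - K. f v \<notin> f ` K}" arbitrary: f)
  case 0
  then have "{v\<in>S - K. f v \<notin> f ` K} = {}" using finite_S by simp
  then show ?case using reaches_refl by blast
next
  case (Suc k)
  then have "{v\<in>S - K. f v \<notin> f ` K} \<noteq> {}" by (metis card.empty nat.distinct(1))
  then obtain w where w: "w \<in> S - K" "f w \<notin> f ` K" by blast
  obtain g where g: "reaches S L 1 f g" "\<And>v. v \<in> K \<Longrightarrow> g v = f v"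
    "{v\<in>S - K. g v \<notin> f ` K} = {v\<in>S - K. f v \<notin> f ` K} - {w}"
    using recolor_one[OF Suc.prems w] by blast
  have "g ` K = f ` K" using g(2) by (rule image_cong[OF HOL.refl])
  then have "card {v\<in>S - K. g v \<notin> g ` K} = k"
    using g(3) Suc.hyps(2) w finite_S by simp
  from Suc.hyps(1)[OF this[symmetric]] reaches_proper[OF g(1) Suc.prems]
  obtain h where h: "reaches S L k g h" "\<forall>v\<in>S - K. h v \<in> h ` K"
    using \<open>card {v\<in>S - K. g v \<notin> g ` K} = k\<close> by auto
  have "reaches S L (Suc k) f h" using reaches_trans[OF g(1) h(1)] by simp
  then show ?case using h(2) Suc.hyps(2) by auto
qed

text \<open>The target color depends on the foot alone and is a cyclic shift: it differs from the
  color of the foot, and distinct feet get distinct colors. To break the cycle, the vertices with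
  foot \<open>a\<close> are parked on a free color. They move twice, all others at most
  once.\<close>

lemma reaches_rotation:
  assumes f: "proper S L f" and small: "\<And>v. v \<in> S - K \<Longrightarrow> f v \<in> f ` K"
    and K: "K = {a, b, c}" "a \<noteq> b" "a \<noteq> c" "b \<noteq> c"
  shows "\<exists>g. reaches S L 2 f g \<and>
    (\<forall>v\<in>S. g v = f (if v \<in> K then v else if foot v = a then c else if foot v = b then a else b))"
proof -
  have "card (f ` K) < card L"
    using clique_card_less[OF K_subset K_clique] card_image_le[OF finite_K, of f] by linarith
  then have "\<not> L \<subseteq> f ` K" using finite_K by (metis card_mono finite_imageI leD)
  then obtain \<delta> where \<delta>: "\<delta> \<in> L" "\<delta> \<notin> f ` K" by blast
  have ne: "f s \<noteq> f t" if "s \<in> S" "t \<in> S" "E s t" for s t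
    using f that unfolding proper_def by blast
  have inL: "f s \<in> L" if "s \<in> S" for s using f that unfolding proper_def by blast
  have Kne: "f a \<noteq> f b" "f a \<noteq> f c" "f b \<noteq> f c"
    using ne K_clique K K_subset by auto
  have \<delta>ne: "\<delta> \<noteq> f a" "\<delta> \<noteq> f b" "\<delta> \<noteq> f c" using \<delta> K by auto
  have KL: "f a \<in> L" "f b \<in> L" "f c \<in> L" using inL K K_subset by auto
  define P where "P x v \<longleftrightarrow> v \<in> S - K \<and> foot v = x" for x v
  have neighbor: "u = x \<or> P y u \<or> P z u" "u \<notin> {v. P x v}"
    if "u \<in> S" "v \<in> {v. P x v}" "E u v" "K = {x, y, z}" for u v x y z
    using that foot_iff[of v u] foot_adjacent[of u v] sym[of u v] foot(1)[of u] unfolding P_def by auto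
  have P_K: "\<not> P y x" if "x \<in> K" for x y using that unfolding P_def by blast
  have P_unique: "P x v \<Longrightarrow> P y v \<Longrightarrow> x = y" for x y v unfolding P_def by simp
  have f_P: "f v \<noteq> f x" if "P x v" for x v
    using ne[of v x] foot[of v] that K_subset unfolding P_def by auto
  have f_\<delta>: "f v \<noteq> \<delta>" if "v \<in> S" for v
    using small[of v] \<delta>(2) that by (cases "v \<in> K") auto
  have abc: "a \<in> K" "b \<in> K" "c \<in> K" using K by auto
  have P_S: "{v. P x v} \<subseteq> S" for x unfolding P_def by blast
  define f1 where "f1 = (\<lambda>v. if v \<in> {v. P a v} then \<delta> else f v)"
  define f2 where "f2 = (\<lambda>v. if v \<in> {v. P c v} then f b else f1 v)"
  define f3 where "f3 = (\<lambda>v. if v \<in> {v. P b v} then f a else f2 v)"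
  define f4 where "f4 = (\<lambda>v. if v \<in> {v. P a v} then f c else f3 v)"
  have f1_eq: "P a v \<Longrightarrow> f1 v = \<delta>" "\<not> P a v \<Longrightarrow> f1 v = f v" for v unfolding f1_def by simp_all
  have f2_eq: "P c v \<Longrightarrow> f2 v = f b" "\<not> P c v \<Longrightarrow> f2 v = f1 v" for v unfolding f2_def by simp_all
  have f3_eq: "P b v \<Longrightarrow> f3 v = f a" "\<not> P b v \<Longrightarrow> f3 v = f2 v" for v unfolding f3_def by simp_all
  have f4_eq: "P a v \<Longrightarrow> f4 v = f c" "\<not> P a v \<Longrightarrow> f4 v = f3 v" for v unfolding f4_def by simp_all
  have disjoint: "P a v \<Longrightarrow> \<not> P b v" "P a v \<Longrightarrow> \<not> P c v" "P b v \<Longrightarrow> \<not> P a v" "P b v \<Longrightarrow> \<not> P c v"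
    "P c v \<Longrightarrow> \<not> P a v" "P c v \<Longrightarrow> \<not> P b v" for v
    using P_unique K(2-4) by blast+
  have K': "K = {c, a, b}" "K = {b, a, c}" using K by auto
  have p1: "proper S L f1" and r1: "recolors S L f (\<lambda>v. if f v = f1 v then 0 else 1) f1"
    unfolding f1_def using recolors_set[OF finite_S f P_S \<delta>(1)] neighbor(2)[OF _ _ _ K(1)] f_\<delta> by blast+
  \<comment> \<open>The order of the rounds matters. A vertex with foot \<open>b\<close> never has
    the color of \<open>b\<close>, and those with foot \<open>a\<close> are parked, so the color of
    \<open>b\<close> is free for the vertices with foot \<open>c\<close>. This in turn frees the
    color of \<open>a\<close>, and then that of \<open>c\<close>.\<close>
  have free2: "u \<notin> {v. P c v} \<and> f1 u \<noteq> f b" if "u \<in> S" "v \<in> {v. P c v}" "E u v" for u v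
  proof
    show "f1 u \<noteq> f b" using neighbor(1)[OF that K'(1)]
    proof (elim disjE)
      assume "P a u" then show ?thesis using f1_eq(1) \<delta>ne by simp
    next
      assume "P b u" then show ?thesis using f1_eq(2)[OF disjoint(3)] f_P by simp
    qed (use f1_eq(2)[OF P_K[OF abc(3)]] Kne in simp)
  qed (rule neighbor(2)[OF that K'(1)])
  have p2: "proper S L f2" and r2: "recolors S L f1 (\<lambda>v. if f1 v = f2 v then 0 else 1) f2"
    unfolding f2_def by (rule recolors_set[OF finite_S p1 P_S KL(2)]; erule (2) free2)+
  have free3: "u \<notin> {v. P b v} \<and> f2 u \<noteq> f a" if "u \<in> S" "v \<in> {v. P b v}" "E u v" for u v
  proof
    show "f2 u \<noteq> f a" using neighbor(1)[OF that K'(2)]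
    proof (elim disjE)
      assume "P a u" then show ?thesis using f1_eq(1) f2_eq(2)[OF disjoint(2)] \<delta>ne by simp
    next
      assume "P c u" then show ?thesis using f2_eq(1) Kne by simp
    qed (use f1_eq(2) f2_eq(2) P_K[OF abc(2)] Kne in simp)
  qed (rule neighbor(2)[OF that K'(2)])
  have p3: "proper S L f3" and r3: "recolors S L f2 (\<lambda>v. if f2 v = f3 v then 0 else 1) f3"
    unfolding f3_def by (rule recolors_set[OF finite_S p2 P_S KL(1)]; erule (2) free3)+
  have free4: "u \<notin> {v. P a v} \<and> f3 u \<noteq> f c" if "u \<in> S" "v \<in> {v. P a v}" "E u v" for u v
  proof
    show "f3 u \<noteq> f c" using neighbor(1)[OF that K(1)]
    proof (elim disjE)
      assume "P b u" then show ?thesis using f3_eq(1) Kne by simp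
    next
      assume "P c u" then show ?thesis using f3_eq(2)[OF disjoint(6)] f2_eq(1) Kne by simp
    qed (use f1_eq(2) f2_eq(2) f3_eq(2) P_K[OF abc(1)] Kne in simp)
  qed (rule neighbor(2)[OF that K(1)])
  have r4: "recolors S L f3 (\<lambda>v. if f3 v = f4 v then 0 else 1) f4"
    unfolding f4_def by (rule recolors_set(2)[OF finite_S p3 P_S KL(3)]; erule (2) free4)
  have "recolors S L f (\<lambda>v. (((if f v = f1 v then 0 else 1) + (if f1 v = f2 v then 0 else 1))
      + (if f2 v = f3 v then 0 else 1)) + (if f3 v = f4 v then 0 else 1)) f4"
    by (rule recolors_trans[OF r4 recolors_trans[OF r3 recolors_trans[OF r2 r1]]])
  moreover have "(((if f v = f1 v then 0 else 1) + (if f1 v = f2 v then 0 else 1))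
      + (if f2 v = f3 v then 0 else 1)) + (if f3 v = f4 v then 0 else 1) \<le> (2 :: nat)" for v
  proof (cases "P a v")
    case True
    then have "f2 v = f1 v" "f3 v = f2 v" using f2_eq(2) f3_eq(2) disjoint by blast+
    then show ?thesis by simp
  next
    case False
    then have "f1 v = f v" "f4 v = f3 v" using f1_eq(2) f4_eq(2) by blast+
    then show ?thesis by simp
  qed
  ultimately have "reaches S L 2 f f4" unfolding reaches_def by blast
  moreover have "f4 v = f (if v \<in> K then v else if foot v = a then c else if foot v = b then a else b)"
    if "v \<in> S" for v
  proof (cases "v \<in> K")
    case True
    then show ?thesis using P_K[OF True] by (simp add: f1_def f2_def f3_def f4_def)
  next
    case False
    then have v: "P (foot v) v" "foot v = a \<or> foot v = b \<or> foot v = c"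
      using that foot(1)[of v] K unfolding P_def by auto
    from v(2) show ?thesis
    proof (elim disjE)
      assume "foot v = a"
      then show ?thesis using v(1) False f4_eq(1) by simp
    next
      assume b: "foot v = b"
      then have "P b v" using v(1) by simp
      then have "f4 v = f a" using f4_eq(2) f3_eq(1) disjoint(3) by simp
      then show ?thesis using b False K(2) by simp
    next
      assume c: "foot v = c"
      then have "P c v" using v(1) by simp
      then have "f4 v = f b" using f4_eq(2) f3_eq(2) f2_eq(1) disjoint(5,6) by simp
      then show ?thesis using c False K(3,4) by simp
    qed
  qed
  ultimately show ?thesis by blast
qed

lemma reaches_of_triangle:
  assumes cd: "proper S L c" "proper S L d" "\<And>v. v \<notin> S \<Longrightarrow> c v = d v"
  shows "reaches S L (2 * card S) c d"
proof -
  obtain x y z where K: "K = {x, y, z}" "x \<noteq> y" "x \<noteq> z" "y \<noteq> z"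
    using card_K by (auto simp: card_3_iff)
  \<comment> \<open>The triangle vertex whose color \<open>v\<close> finally takes. It does not
    depend on the coloring, so both ends arrive at the same classes.\<close>
  define \<kappa> where "\<kappa> v = (if v \<in> K then v else if foot v = x then z else if foot v = y then x else y)" for v
  have bound: "card {v\<in>S - K. f v \<notin> f ` K} \<le> card S - 3" for f :: "'a \<Rightarrow> nat"
  proof -
    have "card {v\<in>S - K. f v \<notin> f ` K} \<le> card (S - K)"
      using finite_S by (intro card_mono) auto
    then show ?thesis using card_K card_Diff_subset[OF finite_K K_subset] by simp
  qed
  have canonical: "\<exists>g. reaches S L (card S - 3 + 2) f g \<and> (\<forall>u\<in>S. \<forall>v\<in>S. g u = g v \<longleftrightarrow> \<kappa> u = \<kappa> v)
      \<and> card (g ` S) \<le> 3"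
    if f: "proper S L f" for f
  proof -
    obtain g where g: "reaches S L (card {v\<in>S - K. f v \<notin> f ` K}) f g" "\<forall>v\<in>S - K. g v \<in> g ` K"
      using reaches_colors_of_K[OF f] by blast
    have g': "proper S L g" using reaches_proper[OF g(1) f] .
    obtain h where h: "reaches S L 2 g h" "\<And>v. v \<in> S \<Longrightarrow> h v = g (\<kappa> v)"
      using reaches_rotation[OF g' _ K] g(2) unfolding \<kappa>_def by blast
    have \<kappa>: "\<kappa> v \<in> K" for v unfolding \<kappa>_def using K by auto
    have "g s \<noteq> g t" if "s \<in> K" "t \<in> K" "s \<noteq> t" for s t
      using g' K_clique[OF that] K_subset that unfolding proper_def by blast
    then have "\<forall>u\<in>S. \<forall>v\<in>S. h u = h v \<longleftrightarrow> \<kappa> u = \<kappa> v"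
      using h(2) \<kappa> by metis
    moreover have "h ` S \<subseteq> g ` K" using h(2) \<kappa> by auto
    then have "card (h ` S) \<le> card (g ` K)" using finite_K by (simp add: card_mono)
    then have "card (h ` S) \<le> 3" using card_image_le[OF finite_K, of g] card_K by simp
    moreover have "reaches S L (card S - 3 + 2) f h"
      using reaches_trans[OF reaches_le[OF g(1) bound] h(1)] .
    ultimately show ?thesis by blast
  qed
  obtain gc where gc: "reaches S L (card S - 3 + 2) c gc" "\<And>u v. u \<in> S \<Longrightarrow> v \<in> S \<Longrightarrow> gc u = gc v \<longleftrightarrow> \<kappa> u = \<kappa> v"
      "card (gc ` S) \<le> 3"
    using canonical[OF cd(1)] by blast
  obtain gd where gd: "reaches S L (card S - 3 + 2) d gd" "\<And>u v. u \<in> S \<Longrightarrow> v \<in> S \<Longrightarrow> gd u = gd v \<longleftrightarrow> \<kappa> u = \<kappa> v"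
    using canonical[OF cd(2)] by blast
  have "reaches S L 2 gc gd"
  proof (rule reaches_same_classes[OF finite_S finite_L])
    show "proper S L gc" "proper S L gd" using reaches_proper gc(1) gd(1) cd by blast+
    show "gc v = gd v" if "v \<notin> S" for v
      using reaches_outside[OF gc(1) that] reaches_outside[OF gd(1) that] cd(3)[OF that] by simp
    show "same_classes S gc gd" using gc(2) gd(2) unfolding same_classes_def by simp
    show "card (gc ` S) < card L" using clique_card_less[OF K_subset K_clique] gc(3) card_K by linarith
  qed
  then have "reaches S L ((card S - 3 + 2) + 2 + (card S - 3 + 2)) c d"
    using reaches_trans[OF reaches_trans[OF gc(1)] reaches_sym[OF gd(1) cd(2)]] by blast
  \<comment> \<open>This makes the truncated subtraction exact; the sum then equals the
    budget.\<close>
  moreover have "3 \<le> card S" using card_mono[OF finite_S K_subset] card_K by simp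
  then have "(card S - 3 + 2) + 2 + (card S - 3 + 2) = 2 * card S" by simp
  ultimately show ?thesis by (simp only:)
qed

end

section \<open>Triangle-free graphs\<close>

locale triangle_free_graph = undominated_graph +
  assumes triangle_free: "\<lbrakk>u \<in> S; v \<in> S; w \<in> S; E u v; E u w\<rbrakk> \<Longrightarrow> \<not> E v w"
begin

text \<open>Any neighbor of \<open>z\<close> that misses \<open>y\<close> will do, since its edge to
  \<open>z\<close> must be connected to the edge \<open>x y\<close>.\<close>

lemma ex_path_to_edge:
  assumes xy: "x \<in> S" "y \<in> S" "E x y" and z: "z \<in> S" "\<not> E z x" "\<not> E z y" "z \<noteq> y"
  shows "\<exists>p\<in>S. E p z \<and> E p x \<and> \<not> E p y"
proof -
  obtain p where p: "p \<in> S" "E p z" "\<not> E p y" using undominated[OF z(1) xy(2) z(4)] by blast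
  moreover have "E p x" using two_K2[OF p(1) z(1) xy(1,2) p(2) xy(3)] p z by blast
  ultimately show ?thesis by blast
qed

lemma far_vertices_independent:
  assumes xy: "x \<in> S" "y \<in> S" "E x y" and z: "z \<in> S" "\<not> E z x" "\<not> E z y"
    and z': "z' \<in> S" "\<not> E z' x" "\<not> E z' y"
  shows "\<not> E z z'"
  using two_K2[OF z(1) z'(1) xy(1,2) _ xy(3)] z(2,3) z'(2,3) by auto

text \<open>If \<open>r\<close> misses \<open>z\<close>, take \<open>p\<close> and \<open>q\<close>
  leading from \<open>z\<close> to the two ends of the edge, and a neighbor \<open>t\<close> of
  \<open>r\<close> that misses \<open>y\<close>. The forbidden triangles and \<open>2K_2\<close>
  determine the adjacencies among these until the edges \<open>t p\<close> and \<open>y q\<close>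
  form a \<open>2K_2\<close>.\<close>

lemma far_vertex_adjacent:
  assumes xy: "x \<in> S" "y \<in> S" "E x y" and z: "z \<in> S" "z \<noteq> x" "z \<noteq> y" "\<not> E z x" "\<not> E z y"
    and r: "r \<in> S" "E r x" "r \<noteq> y"
  shows "E r z"
proof (rule ccontr)
  assume rz: "\<not> E r z"
  obtain p where p: "p \<in> S" "E p z" "E p x" "\<not> E p y"
    using ex_path_to_edge[OF xy z(1,4,5,3)] by blast
  obtain q where q: "q \<in> S" "E q z" "E q y" "\<not> E q x"
    using ex_path_to_edge[OF xy(2,1) sym[OF xy(3)] z(1,5,4,2)] by blast
  have qr: "E q r"
    using two_K2[OF q(1) z(1) r(1) xy(1) q(2) r(2)] q(4) rz z(4) sym by blast
  obtain t where t: "t \<in> S" "E t r" "\<not> E t y" using undominated[OF r(1) xy(2) r(3)] by blast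
  have tx: "\<not> E t x" using triangle_free[OF r(1) xy(1) t(1) r(2)] t(2) sym by blast
  have tz: "\<not> E t z" using far_vertices_independent[OF xy t(1) tx t(3) z(1,4,5)] .
  have rp: "\<not> E r p" using triangle_free[OF xy(1) r(1) p(1)] r(2) p(3) sym by blast
  have tp: "E t p"
    using two_K2[OF t(1) r(1) p(1) z(1) t(2) p(2)] tz rp rz by blast
  have tq: "\<not> E t q" using triangle_free[OF r(1) t(1) q(1)] t(2) qr sym by blast
  have pq: "\<not> E p q" using triangle_free[OF z(1) p(1) q(1)] p(2) q(2) sym by blast
  show False
    using two_K2[OF t(1) p(1) xy(2) q(1) tp sym[OF q(3)]] t(3) tq p(4) pq by blast
qed

text \<open>Otherwise some neighbor \<open>t\<close> of \<open>r\<close> misses \<open>p\<close>. If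
  \<open>t\<close> sees \<open>y\<close>, it also sees \<open>z\<close>, and \<open>z\<close>,
  \<open>t\<close>, \<open>r\<close> is a triangle. If not, \<open>t\<close> is far from the edge
  \<open>x y\<close> and hence adjacent to \<open>p\<close> after all.\<close>

lemma near_vertices_eq:
  assumes xy: "x \<in> S" "y \<in> S" "E x y" and z: "z \<in> S" "z \<noteq> x" "z \<noteq> y" "\<not> E z x" "\<not> E z y"
    and r: "r \<in> S" "E r x" "r \<noteq> y" and p: "p \<in> S" "E p x" "p \<noteq> y"
  shows "r = p"
proof (rule ccontr)
  assume "r \<noteq> p"
  then obtain t where t: "t \<in> S" "E t r" "\<not> E t p" using undominated[OF r(1) p(1)] by blast
  have tx: "\<not> E t x" using triangle_free[OF r(1) xy(1) t(1) r(2)] t(2) sym by blast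
  have "t \<noteq> x" using t(3) p(2) sym by blast
  have rz: "E r z" using far_vertex_adjacent[OF xy z r] .
  show False
  proof (cases "E t y")
    case True
    then have "E t z"
      using far_vertex_adjacent[OF xy(2,1) sym[OF xy(3)] z(1,3,2,5,4) t(1)] \<open>t \<noteq> x\<close> by blast
    then show False using triangle_free[OF z(1) t(1) r(1)] rz t(2) sym by blast
  next
    case False
    have "t \<noteq> y" using tx sym[OF xy(3)] by blast
    then show False
      using far_vertex_adjacent[OF xy t(1) \<open>t \<noteq> x\<close> _ tx False p] t(3) sym by blast
  qed
qed

text \<open>A further neighbor \<open>v\<close> of \<open>x\<close> has a neighbor \<open>t\<close>
  missing \<open>y\<close>; then \<open>t\<close> sees \<open>x\<close> and closes a
  triangle.\<close>

lemma no_far_vertex_eq: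
  assumes xy: "x \<in> S" "y \<in> S" "E x y" and near: "\<And>z. z \<in> S \<Longrightarrow> E z x \<or> E z y"
  shows "S = {x, y}"
proof -
  have "v = y" if xy: "x \<in> S" "y \<in> S" "E x y" and near: "\<And>z. z \<in> S \<Longrightarrow> E z x \<or> E z y"
    and v: "v \<in> S" "E v x" for x y v
  proof (rule ccontr)
    assume "v \<noteq> y"
    then obtain t where t: "t \<in> S" "E t v" "\<not> E t y" using undominated[OF v(1) xy(2)] by blast
    then have "E t x" using near by blast
    then show False using triangle_free[OF xy(1) t(1) v(1)] t(2) v(2) sym by blast
  qed
  from this[OF xy near] this[OF xy(2,1) sym[OF xy(3)]] near show ?thesis using xy by blast
qed

text \<open>The common target pattern colors \<open>q\<close> like \<open>x\<close>,
  \<open>p\<close> like \<open>y\<close>, and \<open>z\<close> differently from both. Three moves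
  per vertex from either end and two for the permutation make 8, within the budget of 10.\<close>

lemma reaches_of_C5:
  assumes S: "S = {x, y, q, z, p}"
    and E: "E x y" "E y q" "E q z" "E z p" "E p x"
    and cd: "proper S L c" "proper S L d" "\<And>v. v \<notin> S \<Longrightarrow> c v = d v"
  shows "reaches S L (2 * card S) c d"
proof -
  have in_S: "x \<in> S" "y \<in> S" "q \<in> S" "z \<in> S" "p \<in> S" using S by auto
  have non: "\<not> E x q" "\<not> E q x" "\<not> E y z" "\<not> E z y" "\<not> E q p" "\<not> E p q" "\<not> E z x" "\<not> E x z"
      "\<not> E p y" "\<not> E y p"
    using triangle_free in_S E sym by meson+
  have distinct: "x \<noteq> y" "x \<noteq> q" "x \<noteq> z" "x \<noteq> p" "y \<noteq> q" "y \<noteq> z" "y \<noteq> p" "q \<noteq> z" "q \<noteq> p" "z \<noteq> p"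
    using E non irrefl sym by metis+
  have "3 < card L"
  proof (rule rainbow_card_less)
    fix h M assume h: "proper S M h"
    have ne: "h u \<noteq> h v" if "u \<in> S" "v \<in> S" "E u v" for u v
      using h that unfolding proper_def by blast
    \<comment> \<open>With the colors of \<open>x\<close> and \<open>y\<close> only, the path
      \<open>q\<close>, \<open>z\<close>, \<open>p\<close> would alternate and give \<open>p\<close>
      the color of its neighbor \<open>x\<close>.\<close>
    have "\<exists>t\<in>{p, q, z}. h t \<noteq> h x \<and> h t \<noteq> h y"
      using ne[OF _ _ E(2)] ne[OF _ _ E(3)] ne[OF _ _ E(4)] ne[OF _ _ E(5)] in_S by fastforce
    then obtain t where t: "t \<in> {p, q, z}" "h t \<noteq> h x" "h t \<noteq> h y" by blast
    have "card {x, y, t} = 3" using t distinct by auto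
    moreover have "inj_on h {x, y, t}" using t ne[OF _ _ E(1)] in_S by (auto simp: inj_on_def)
    moreover have "{x, y, t} \<subseteq> S" using t(1) in_S by auto
    ultimately show "\<exists>U\<subseteq>S. card U = 3 \<and> inj_on h U" by (intro exI conjI)
  qed
  have fresh: "\<exists>k\<in>L. k \<notin> A" if "card A \<le> 3" "finite A" for A
    using \<open>3 < card L\<close> that by (metis card_mono leD le_trans subsetI)
  have freeing: "\<exists>e. reaches S L 2 f e \<and> e z \<noteq> f x \<and> e z \<noteq> f y \<and> e x = f x \<and> e y = f y"
    if S: "S = {x, y, q, z, p}" and E: "E x y" "E y q" "E q z" "E z p" "E p x"
      and non: "\<not> E q p" "\<not> E y p" "\<not> E x z" "\<not> E y z"
      and distinct: "x \<noteq> z" "y \<noteq> z" "x \<noteq> p" "y \<noteq> p" "z \<noteq> p" "q \<noteq> p"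
      and f: "proper S L f" "f z = f x" for x y q p f
  proof -
    have ne: "f u \<noteq> f v" if "u \<in> S" "v \<in> S" "E u v" for u v
      using f that unfolding proper_def by blast
    have inL: "f u \<in> L" if "u \<in> S" for u using f that unfolding proper_def by blast
    \<comment> \<open>Four colors are guaranteed, so \<open>z\<close> can afford to avoid only
      three. Moving \<open>p\<close> to the color of \<open>y\<close> first removes the old color of
      \<open>p\<close> from the list.\<close>
    have "card {f x, f y, f q} \<le> 3" by (simp add: card_insert_le_m1)
    then obtain k where k: "k \<in> L" "k \<notin> {f x, f y, f q}" using fresh[of "{f x, f y, f q}"] by blast
    have 1: "recolors S L f (\<lambda>v. if v = p then 1 else 0) (f(p := f y))"
      by (rule recolors_single) (use S non f(2) ne[of x y] E irrefl inL in auto)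
    have 2: "recolors S L (f(p := f y)) (\<lambda>v. if v = z then 1 else 0) ((f(p := f y))(z := k))"
      by (rule recolors_single) (use S k non irrefl in auto)
    have "reaches S L 2 f ((f(p := f y))(z := k))"
      unfolding reaches_def by (intro exI conjI) (rule recolors_trans[OF 2 1], simp)
    then show ?thesis using k(2) distinct by (intro exI[of _ "(f(p := f y))(z := k)"]) auto
  qed
  have canonical: "\<exists>g. reaches S L 3 f g \<and> g q = g x \<and> g p = g y \<and> g z \<noteq> g x \<and> g z \<noteq> g y \<and> g x \<noteq> g y"
    if f: "proper S L f" for f
  proof -
    have "\<exists>e. reaches S L 2 f e \<and> e z \<noteq> f x \<and> e z \<noteq> f y \<and> e x = f x \<and> e y = f y"
    proof (cases "f z = f x")
      case True
      then show ?thesis using freeing[OF S E] non distinct f by blast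
    next
      case zx: False
      show ?thesis
      proof (cases "f z = f y")
        case True
        \<comment> \<open>The reflection of the cycle exchanging \<open>x\<close> with
          \<open>y\<close> and \<open>p\<close> with \<open>q\<close>.\<close>
        have "S = {y, x, p, z, q}" using S by blast
        from freeing[OF this] show ?thesis using E sym non distinct f True by metis
      next
        case False
        then show ?thesis using zx reaches_refl by blast
      qed
    qed
    then obtain e where e: "reaches S L 2 f e" "e z \<noteq> e x" "e z \<noteq> e y" by metis
    have e': "proper S L e" using reaches_proper e(1) f by blast
    have ne: "e x \<noteq> e y" using e' E(1) in_S unfolding proper_def by blast
    define g where "g = e(q := e x, p := e y)"
    have g: "g x = e x" "g y = e y" "g z = e z" "g q = e x" "g p = e y"
      using distinct unfolding g_def by auto
    have nbrs: "(u, v) \<in> {(x, y), (y, x), (y, q), (q, y), (q, z), (z, q), (z, p), (p, z), (p, x), (x, p)}"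
      if "u \<in> S" "v \<in> S" "E u v" for u v
    proof -
      have "u \<in> {x, y, q, z, p}" "v \<in> {x, y, q, z, p}" using that(1,2) S by blast+
      then show ?thesis using that(3) non irrefl by (elim insertE emptyE; simp)
    qed
    note simps = g e(2,3) e(2,3)[symmetric] ne ne[symmetric]
    have "proper S L g"
      unfolding proper_def
    proof (intro conjI ballI impI)
      fix u v assume "u \<in> S" "v \<in> S" "E u v"
      from nbrs[OF this] show "g u \<noteq> g v"
        by (elim insertE emptyE Pair_inject) (simp_all add: simps)
    next
      fix v assume "v \<in> S"
      then show "g v \<in> L" using e' in_S unfolding proper_def g_def by simp
    qed
    then have "recolors S L e (\<lambda>v. if e v = g v then 0 else 1) g"
    proof (rule recolors_compatible[OF finite_S e'])
      fix u v assume uv: "u \<in> S" "v \<in> S" "E u v"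
      have "e u \<noteq> e v" using e' uv unfolding proper_def by blast
      then show "e u \<noteq> g v" using nbrs[OF uv]
        by (elim insertE emptyE Pair_inject) (simp_all add: simps)
    next
      fix v assume "v \<notin> S"
      then show "e v = g v" using in_S unfolding g_def by auto
    qed
    then have "reaches S L 1 e g" unfolding reaches_def by (intro exI conjI) auto
    then have "reaches S L 3 f g" using reaches_trans[OF e(1), of 1 g] by (simp add: eval_nat_numeral)
    then show ?thesis using g e(2,3) ne by metis
  qed
  obtain gc where gc: "reaches S L 3 c gc" "gc q = gc x" "gc p = gc y" "gc z \<noteq> gc x" "gc z \<noteq> gc y" "gc x \<noteq> gc y"
    using canonical[OF cd(1)] by blast
  obtain gd where gd: "reaches S L 3 d gd" "gd q = gd x" "gd p = gd y" "gd z \<noteq> gd x" "gd z \<noteq> gd y" "gd x \<noteq> gd y"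
    using canonical[OF cd(2)] by blast
  have "reaches S L 2 gc gd"
  proof (rule reaches_same_classes[OF finite_S finite_L])
    show "proper S L gc" "proper S L gd" using reaches_proper gc(1) gd(1) cd by blast+
    show "gc v = gd v" if "v \<notin> S" for v
      using reaches_outside[OF gc(1) that] reaches_outside[OF gd(1) that] cd(3)[OF that] by simp
    show "same_classes S gc gd"
      using gc(2-) gd(2-) unfolding same_classes_def S by auto
    have "gc ` S = {gc x, gc y, gc z}" unfolding S using gc by auto
    then show "card (gc ` S) < card L" using \<open>3 < card L\<close> by (simp add: card_insert_if split: if_splits)
  qed
  then have "reaches S L (3 + 2 + 3) c d"
    using reaches_trans[OF reaches_trans[OF gc(1)] reaches_sym[OF gd(1) cd(2)]] by blast
  moreover have "card S = 5" unfolding S using distinct by simp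
  ultimately show ?thesis by (auto intro: reaches_le)
qed

lemma reaches_of_triangle_free:
  assumes cd: "proper S L c" "proper S L d" "\<And>v. v \<notin> S \<Longrightarrow> c v = d v"
  shows "reaches S L (2 * card S) c d"
proof (cases "\<exists>x\<in>S. \<exists>y\<in>S. E x y")
  case False
  \<comment> \<open>Without edges all neighborhoods are empty and thus contained in one another,
    which leaves at most one vertex.\<close>
  then have "u = v" if "u \<in> S" "v \<in> S" for u v using undominated that by blast
  then show ?thesis using reaches_complete cd by blast
next
  case True
  then obtain x y where xy: "x \<in> S" "y \<in> S" "E x y" by blast
  show ?thesis
  proof (cases "\<forall>z\<in>S. E z x \<or> E z y")
    case True
    then have S: "S = {x, y}" using no_far_vertex_eq[OF xy] by blast
    have "E u v" if "u \<in> S" "v \<in> S" "u \<noteq> v" for u v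
      using that xy(3) sym unfolding S by blast
    then show ?thesis using reaches_complete cd by blast
  next
    case False
    then obtain z where z: "z \<in> S" "\<not> E z x" "\<not> E z y" by blast
    then have z': "z \<noteq> x" "z \<noteq> y" using xy(3) sym by blast+
    note z = z(1) z' z(2,3)
    note yx = xy(2,1) sym[OF xy(3)]
    obtain p where p: "p \<in> S" "E p z" "E p x" "\<not> E p y"
      using ex_path_to_edge[OF xy z(1,4,5,3)] by blast
    obtain q where q: "q \<in> S" "E q z" "E q y" "\<not> E q x"
      using ex_path_to_edge[OF yx z(1,5,4,2)] by blast
    have "p \<noteq> y" "q \<noteq> x" using p q z sym by blast+
    have "r \<in> {x, y, q, z, p}" if r: "r \<in> S" for r
    proof (cases "E r x \<or> E r y")
      case True
      then show ?thesis
        using near_vertices_eq[OF xy z r _ _ p(1,3) \<open>p \<noteq> y\<close>]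
          near_vertices_eq[OF yx z(1,3,2,5,4) r _ _ q(1,3) \<open>q \<noteq> x\<close>] by blast
    next
      case False
      show ?thesis
      proof (rule ccontr)
        assume far: "r \<notin> {x, y, q, z, p}"
        \<comment> \<open>Only \<open>p\<close> and \<open>q\<close> could connect \<open>t\<close>
          to the edge \<open>x y\<close>, but both see \<open>z\<close>. So \<open>t\<close> is far
          from this edge, like its neighbor \<open>r\<close>, although far vertices are
          independent.\<close>
        then obtain t where t: "t \<in> S" "E t r" "\<not> E t z" using undominated[OF r z(1)] by blast
        have "\<not> E t x" "\<not> E t y"
          using near_vertices_eq[OF xy z t(1) _ _ p(1,3) \<open>p \<noteq> y\<close>] p(2) t False
            near_vertices_eq[OF yx z(1,3,2,5,4) t(1) _ _ q(1,3) \<open>q \<noteq> x\<close>] q(2) sym by blast+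
        then show False using far_vertices_independent[OF xy t(1) _ _ r] False t(2) by blast
      qed
    qed
    then have "S = {x, y, q, z, p}" using xy z p q by blast
    from reaches_of_C5[OF this xy(3) sym[OF q(3)] q(2) sym[OF p(2)] p(3) cd] show ?thesis .
  qed
qed

end

section \<open>Distinguishing the cases by a maximal clique\<close>

context undominated_graph
begin

lemma reaches_of_undominated:
  assumes cd: "proper S L c" "proper S L d" "\<And>v. v \<notin> S \<Longrightarrow> c v = d v"
  shows "reaches S L (2 * card S) c d"
proof (cases "\<forall>u\<in>S. \<forall>v\<in>S. \<forall>w\<in>S. E u v \<longrightarrow> E u w \<longrightarrow> \<not> E v w")
  case True
  interpret triangle_free_graph E S L
  proof unfold_locales
    fix u v w assume "u \<in> S" "v \<in> S" "w \<in> S" "E u v" "E u w"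
    then show "\<not> E v w" by (rule True[rule_format])
  qed
  show ?thesis using reaches_of_triangle_free cd by blast
next
  case False
  then have "\<exists>u\<in>S. \<exists>v\<in>S. \<exists>w\<in>S. E u v \<and> E u w \<and> E v w" by metis
  then obtain u v w where uvw: "u \<in> S" "v \<in> S" "w \<in> S" "E u v" "E u w" "E v w" by blast
  define cliques where "cliques = {K. K \<subseteq> S \<and> (\<forall>u\<in>K. \<forall>v\<in>K. u \<noteq> v \<longrightarrow> E u v)}"
  have "cliques \<subseteq> Pow S" unfolding cliques_def by blast
  then have fin: "finite cliques" using finite_S finite_subset by blast
  have "{u, v, w} \<in> cliques"
    using uvw sym[OF uvw(4)] sym[OF uvw(5)] sym[OF uvw(6)] unfolding cliques_def by simp
  then obtain K where K: "K \<in> cliques" "{u, v, w} \<subseteq> K" "\<And>K'. K' \<in> cliques \<Longrightarrow> K \<subseteq> K' \<Longrightarrow> K = K'"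
    using finite_has_maximal2[OF fin] by metis
  have clique: "K \<subseteq> S" "\<And>u v. u \<in> K \<Longrightarrow> v \<in> K \<Longrightarrow> u \<noteq> v \<Longrightarrow> E u v"
    using K(1) unfolding cliques_def by blast+
  interpret maximal_clique_graph E S L K
  proof unfold_locales
    show "K \<subseteq> S" "\<And>u v. u \<in> K \<Longrightarrow> v \<in> K \<Longrightarrow> u \<noteq> v \<Longrightarrow> E u v"
      by (fact clique)+
    show "\<exists>k\<in>K. \<not> E v k" if v: "v \<in> S - K" for v
    proof (rule ccontr)
      assume "\<not> ?thesis"
      then have v_K: "E v k" "E k v" if "k \<in> K" for k using that sym by blast+
      have "E s t" if "s \<in> insert v K" "t \<in> insert v K" "s \<noteq> t" for s t
        using that clique(2) v_K by blast
      moreover have "insert v K \<subseteq> S" using clique(1) v by blast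
      ultimately have "insert v K \<in> cliques" unfolding cliques_def by blast
      then show False using K(3)[of "insert v K"] v by blast
    qed
  qed
  have "u \<noteq> v" "u \<noteq> w" "v \<noteq> w" using uvw irrefl by blast+
  then have "card {u, v, w} = 3" by simp
  then have "3 \<le> card K" using card_mono[OF finite_K K(2)] by simp
  then consider "card K = 3" | "card K \<ge> 4" by linarith
  then show ?thesis
  proof cases
    case 1
    interpret maximal_triangle_graph E S L K by unfold_locales (rule 1)
    show ?thesis using reaches_of_triangle cd by blast
  next
    case 2
    show ?thesis using reaches_complete K_clique cd unfolding eq_K_if_card_ge_4[OF 2] by blast
  qed
qed

end

section \<open>Removing dominated vertices\<close>

context simple_graph
begin

text \<open>Coinciding vertices are harmless: if \<open>u = x\<close>, for instance, then
  \<open>E v x\<close> follows by symmetry.\<close>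

definition two_K2_free_on :: "'a set \<Rightarrow> bool" where
  "two_K2_free_on S \<longleftrightarrow> (\<forall>u\<in>S. \<forall>v\<in>S. \<forall>x\<in>S. \<forall>y\<in>S.
    E u v \<longrightarrow> E x y \<longrightarrow> E u x \<or> E u y \<or> E v x \<or> E v y)"

definition diamond_free_on :: "'a set \<Rightarrow> bool" where
  "diamond_free_on S \<longleftrightarrow> (\<forall>u\<in>S. \<forall>v\<in>S. \<forall>x\<in>S. \<forall>y\<in>S.
    E u v \<longrightarrow> E x u \<longrightarrow> E x v \<longrightarrow> E y u \<longrightarrow> E y v \<longrightarrow> x \<noteq> y \<longrightarrow> E x y)"

theorem reaches_of_free:
  assumes "finite S" "finite L" "two_K2_free_on S" "diamond_free_on S"
    and "\<exists>M h. finite M \<and> card M < card L \<and> proper S M h"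
    and "proper S L c" "proper S L d" "\<And>v. v \<notin> S \<Longrightarrow> c v = d v"
  shows "reaches S L (2 * card S) c d"
  using assms
\<comment> \<open>Here \<open>c\<close> stays fixed while \<open>d\<close> varies: for
  \<open>S - {u}\<close> it is reset at \<open>u\<close> to agree with \<open>c\<close> outside the
  smaller set.\<close>
proof (induction "card S" arbitrary: S d)
  case 0
  then have "c = d" by auto
  then show ?case by (simp add: reaches_refl)
next
  case (Suc k)
  show ?case
  proof (cases "\<forall>u\<in>S. \<forall>v\<in>S. u \<noteq> v \<longrightarrow> (\<exists>w\<in>S. E w u \<and> \<not> E w v)")
    case True
    have "undominated_graph E S L"
    proof unfold_locales
      show "\<And>u v. u \<in> S \<Longrightarrow> v \<in> S \<Longrightarrow> u \<noteq> v \<Longrightarrow> \<exists>w\<in>S. E w u \<and> \<not> E w v" using True by blast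
      show "\<And>u v x y. \<lbrakk>u \<in> S; v \<in> S; x \<in> S; y \<in> S; E u v; E x y\<rbrakk> \<Longrightarrow> E u x \<or> E u y \<or> E v x \<or> E v y"
        using Suc.prems(3) unfolding two_K2_free_on_def by blast
      show "\<And>u v x y. \<lbrakk>u \<in> S; v \<in> S; x \<in> S; y \<in> S; E u v; E x u; E x v; E y u; E y v; x \<noteq> y\<rbrakk> \<Longrightarrow> E x y"
        using Suc.prems(4) unfolding diamond_free_on_def by blast
    qed (rule Suc.prems(1,2,5))+
    then show ?thesis using undominated_graph.reaches_of_undominated Suc.prems(6-8) by blast
  next
    case False
    then obtain u v where uv: "u \<in> S" "v \<in> S" "u \<noteq> v" "\<And>w. w \<in> S \<Longrightarrow> E w u \<Longrightarrow> E w v" by blast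
    have card: "k = card (S - {u})" using Suc.hyps(2) Suc.prems(1) uv(1) by simp
    have sub: "S - {u} \<subseteq> S" by blast
    have "reaches (S - {u}) L (2 * card (S - {u})) c (d(u := c u))"
    proof (rule Suc.hyps(1)[OF card])
      show "two_K2_free_on (S - {u})" "diamond_free_on (S - {u})"
        using Suc.prems(3,4) unfolding two_K2_free_on_def diamond_free_on_def by blast+
      show "\<exists>M h. finite M \<and> card M < card L \<and> proper (S - {u}) M h"
        using Suc.prems(5) proper_subset[OF _ sub] by blast
      show "proper (S - {u}) L c" using Suc.prems(6) proper_subset[OF _ sub] by blast
      show "proper (S - {u}) L (d(u := c u))" using Suc.prems(7) unfolding proper_def by auto
    qed (use Suc.prems in auto)
    then have "reaches S L (2 * card (S - {u}) + 2) c d"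
      using reaches_dominated[OF Suc.prems(6,7) uv(2,1,3,4)] by blast
    moreover have "2 * card (S - {u}) + 2 = 2 * card S" using card Suc.hyps(2) by simp
    ultimately show ?thesis by (simp only:)
  qed
qed

end

section \<open>Colorings of graphs\<close>

lemma simple_graph_parcs:
  assumes "pair_graph G"
  shows "simple_graph (\<lambda>u v. (u, v) \<in> parcs G)"
proof -
  interpret pair_graph G by (rule assms)
  show ?thesis
  proof
    show "(v, u) \<in> parcs G" if "(u, v) \<in> parcs G" for u v
      using pair_sym_arcs that by (auto simp: symmetric_def dest: symD)
    show "(u, u) \<notin> parcs G" for u
      using pair_no_loops by fastforce
  qed
qed

text \<open>The copy of \<open>H\<close> has to live inside \<open>G\<close>, so it is taken as the
  image under \<open>\<phi>\<close>. That \<open>\<phi>\<close> also reflects arcs makes this image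
  induced.\<close>

lemma not_free_of:
  assumes G: "pair_graph G" and H: "pair_graph H"
    and inj: "inj_on \<phi> (pverts H)" and sub: "\<phi> ` pverts H \<subseteq> pverts G"
    and arcs: "\<And>i j. i \<in> pverts H \<Longrightarrow> j \<in> pverts H \<Longrightarrow> (i, j) \<in> parcs H \<longleftrightarrow> (\<phi> i, \<phi> j) \<in> parcs G"
  shows "\<not> free_of H G"
proof -
  interpret G: pair_graph G by (rule G)
  interpret H: pair_graph H by (rule H)
  let ?f = "\<lparr>iso_verts = \<phi>, iso_arcs = map_prod \<phi> \<phi>, iso_head = snd, iso_tail = fst\<rparr>"
  let ?K = "app_iso ?f (with_proj H)"
  have arcs_K: "arcs ?K = {e \<in> parcs G. fst e \<in> \<phi> ` pverts H \<and> snd e \<in> \<phi> ` pverts H}"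
  proof (intro equalityI subsetI)
    fix e assume "e \<in> arcs ?K"
    then obtain i j where "(i, j) \<in> parcs H" "e = (\<phi> i, \<phi> j)" by auto
    then show "e \<in> {e \<in> parcs G. fst e \<in> \<phi> ` pverts H \<and> snd e \<in> \<phi> ` pverts H}"
      using arcs[of i j] H.in_arcsD1[of i j] H.in_arcsD2[of i j] by auto
  next
    fix e assume "e \<in> {e \<in> parcs G. fst e \<in> \<phi> ` pverts H \<and> snd e \<in> \<phi> ` pverts H}"
    then obtain i j where "i \<in> pverts H" "j \<in> pverts H" "e = (\<phi> i, \<phi> j)" "(\<phi> i, \<phi> j) \<in> parcs G"
      by (cases e) auto
    then show "e \<in> arcs ?K" using arcs[of i j] by force
  qed
  have "inj_on (map_prod \<phi> \<phi>) (parcs H)"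
  proof (rule inj_on_subset)
    show "inj_on (map_prod \<phi> \<phi>) (pverts H \<times> pverts H)" using inj by (intro map_prod_inj_on)
    show "parcs H \<subseteq> pverts H \<times> pverts H" using H.in_arcsD1 H.in_arcsD2 by auto
  qed
  then have iso: "pre_digraph.digraph_isomorphism (with_proj H) ?f"
    unfolding pre_digraph.digraph_isomorphism_def using inj H.wf_digraph_axioms by auto
  then have "digraph_iso (with_proj H) ?K" unfolding digraph_iso_def by blast
  then have "digraph_iso ?K (with_proj H)" using digraph_iso_swap H.wf_digraph_axioms by blast
  moreover have "wf_digraph ?K" using H.wf_digraphI_app_iso[OF iso] .
  then have "induced_subgraph ?K (with_proj G)"
    unfolding induced_subgraph_def subgraph_def compatible_def
    using arcs_K sub G.wf_digraph_axioms by auto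
  ultimately show ?thesis unfolding free_of_def by blast
qed

lemma two_K2_free_on_pverts:
  assumes G: "pair_graph G" and free: "free_of two_K2 G"
  shows "simple_graph.two_K2_free_on (\<lambda>u v. (u, v) \<in> parcs G) (pverts G)"
proof -
  interpret simple_graph "\<lambda>u v. (u, v) \<in> parcs G" using simple_graph_parcs[OF G] .
  show ?thesis
    unfolding two_K2_free_on_def
  proof (intro ballI impI, rule ccontr)
    fix u v x y
    assume V: "u \<in> pverts G" "v \<in> pverts G" "x \<in> pverts G" "y \<in> pverts G"
      and e: "(u, v) \<in> parcs G" "(x, y) \<in> parcs G"
      and "\<not> ((u, x) \<in> parcs G \<or> (u, y) \<in> parcs G \<or> (v, x) \<in> parcs G \<or> (v, y) \<in> parcs G)"
    then have non: "(u, x) \<notin> parcs G" "(u, y) \<notin> parcs G" "(v, x) \<notin> parcs G" "(v, y) \<notin> parcs G" by auto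
    have non': "(x, u) \<notin> parcs G" "(y, u) \<notin> parcs G" "(x, v) \<notin> parcs G" "(y, v) \<notin> parcs G"
      using non sym by blast+
    have distinct: "u \<noteq> v" "u \<noteq> x" "u \<noteq> y" "v \<noteq> x" "v \<noteq> y" "x \<noteq> y"
      using e non sym irrefl by metis+
    define \<phi> where "\<phi> i = (if i = 0 then u else if i = 1 then v else if i = 2 then x else y)" for i :: nat
    have \<phi>: "\<phi> 0 = u" "\<phi> (Suc 0) = v" "\<phi> 1 = v" "\<phi> 2 = x" "\<phi> 3 = y" unfolding \<phi>_def by simp_all
    have "\<not> free_of two_K2 G"
    proof (rule not_free_of[OF G pair_graph_two_K2])
      show "inj_on \<phi> (pverts two_K2)"
        using distinct distinct[symmetric] unfolding two_K2_def by (simp add: \<phi>)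
      show "\<phi> ` pverts two_K2 \<subseteq> pverts G" using V unfolding two_K2_def by (simp add: \<phi>)
      fix i j assume "i \<in> pverts two_K2" "j \<in> pverts two_K2"
      then have "i \<in> {0, 1, 2, 3}" "j \<in> {0, 1, 2, 3}" unfolding two_K2_def by simp_all
      then show "(i, j) \<in> parcs two_K2 \<longleftrightarrow> (\<phi> i, \<phi> j) \<in> parcs G"
        unfolding two_K2_def symcl_def
        by (elim insertE emptyE) (simp_all add: \<phi> e e[THEN sym] non non' irrefl)
    qed
    then show False using free by simp
  qed
qed

lemma diamond_free_on_pverts:
  assumes G: "pair_graph G" and free: "free_of diamond G"
  shows "simple_graph.diamond_free_on (\<lambda>u v. (u, v) \<in> parcs G) (pverts G)"
proof -
  interpret simple_graph "\<lambda>u v. (u, v) \<in> parcs G" using simple_graph_parcs[OF G] .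
  show ?thesis
    unfolding diamond_free_on_def
  proof (intro ballI impI, rule ccontr)
    fix u v x y
    assume V: "u \<in> pverts G" "v \<in> pverts G" "x \<in> pverts G" "y \<in> pverts G"
      and e: "(u, v) \<in> parcs G" "(x, u) \<in> parcs G" "(x, v) \<in> parcs G" "(y, u) \<in> parcs G" "(y, v) \<in> parcs G"
      and "x \<noteq> y" and non: "(x, y) \<notin> parcs G"
    have non': "(y, x) \<notin> parcs G" using non sym by blast
    have distinct: "u \<noteq> v" "u \<noteq> x" "u \<noteq> y" "v \<noteq> x" "v \<noteq> y" "x \<noteq> y"
      using e irrefl \<open>x \<noteq> y\<close> by metis+
    define \<phi> where "\<phi> i = (if i = 0 then u else if i = 1 then v else if i = 2 then x else y)" for i :: nat
    have \<phi>: "\<phi> 0 = u" "\<phi> (Suc 0) = v" "\<phi> 1 = v" "\<phi> 2 = x" "\<phi> 3 = y" unfolding \<phi>_def by simp_all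
    have "\<not> free_of diamond G"
    proof (rule not_free_of[OF G pair_graph_diamond])
      show "inj_on \<phi> (pverts diamond)"
        using distinct distinct[symmetric] unfolding diamond_def by (simp add: \<phi>)
      show "\<phi> ` pverts diamond \<subseteq> pverts G" using V unfolding diamond_def by (simp add: \<phi>)
      fix i j assume "i \<in> pverts diamond" "j \<in> pverts diamond"
      then have "i \<in> {0, 1, 2, 3}" "j \<in> {0, 1, 2, 3}" unfolding diamond_def by simp_all
      then show "(i, j) \<in> parcs diamond \<longleftrightarrow> (\<phi> i, \<phi> j) \<in> parcs G"
        unfolding diamond_def
        by (elim insertE emptyE) (simp_all add: \<phi> e e[THEN sym] non non' irrefl)
    qed
    then show False using free by simp
  qed
qed

lemma colorings_iff_proper:
  assumes "pair_graph G"
  shows "c \<in> colorings G k \<longleftrightarrow> simple_graph.proper (\<lambda>u v. (u, v) \<in> parcs G) (pverts G) {1..k} c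
    \<and> (\<forall>v. v \<notin> pverts G \<longrightarrow> c v = undefined)"
proof -
  interpret pair_graph G by (rule assms)
  interpret simple_graph "\<lambda>u v. (u, v) \<in> parcs G" using simple_graph_parcs[OF assms] .
  have "(\<forall>(u, v) \<in> parcs G. c u \<noteq> c v)
      \<longleftrightarrow> (\<forall>u\<in>pverts G. \<forall>v\<in>pverts G. (u, v) \<in> parcs G \<longrightarrow> c u \<noteq> c v)"
    using in_arcsD1 in_arcsD2 by fast
  moreover have "c \<in> pverts G \<rightarrow>\<^sub>E {1..k}
      \<longleftrightarrow> (\<forall>v\<in>pverts G. c v \<in> {1..k}) \<and> (\<forall>v. v \<notin> pverts G \<longrightarrow> c v = undefined)"
    unfolding PiE_iff extensional_def by blast
  ultimately show ?thesis unfolding colorings_def proper_def by blast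
qed

text \<open>Moves that keep the color are not arcs of the recoloring graph. They are skipped, hence
  only an upper bound on the length.\<close>

lemma awalk_of_recolors:
  assumes G: "pair_graph G" and c: "c \<in> colorings G l"
    and r: "simple_graph.recolors (\<lambda>u v. (u, v) \<in> parcs G) (pverts G) {1..l} c n d"
  shows "\<exists>p. pre_digraph.awalk (with_proj (recoloring_graph G l)) c p d \<and> length p \<le> sum n (pverts G)"
proof -
  interpret G: pair_graph G by (rule G)
  interpret simple_graph "\<lambda>u v. (u, v) \<in> parcs G" using simple_graph_parcs[OF G] .
  interpret R: pair_graph "recoloring_graph G l" using pair_graph_recoloring_graph[OF G] .
  have verts: "pverts (recoloring_graph G l) = colorings G l" unfolding recoloring_graph_def by simp
  have coloring: "d \<in> colorings G l" if "recolors (pverts G) {1..l} c n d" for n d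
    using c recolors_proper[OF that] recolors_outside(1)[OF that]
    unfolding colorings_iff_proper[OF G] by simp
  show ?thesis
    using r
  proof induction
    case refl
    have "R.awalk c [] c" using c verts by (simp add: R.awalk_Nil_iff)
    then show ?case by (intro exI[of _ "[]"]) simp
  next
    case (step n d v x)
    obtain p where p: "R.awalk c p d" "length p \<le> sum n (pverts G)" using step.IH by blast
    have sum: "sum (n(v := Suc (n v))) (pverts G) = Suc (sum n (pverts G))"
      using sum.remove[OF G.pair_finite_verts step.hyps(2), of n]
        sum.remove[OF G.pair_finite_verts step.hyps(2), of "n(v := Suc (n v))"] by simp
    show ?case
    proof (cases "d v = x")
      case True
      then have "d(v := x) = d" by auto
      then show ?thesis using p sum by auto
    next
      case False
      have "\<exists>!u. u \<in> pverts G \<and> d u \<noteq> (d(v := x)) u"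
        using False step.hyps(2) by (intro ex1I[of _ v]) (auto split: if_splits)
      then have "(d, d(v := x)) \<in> parcs (recoloring_graph G l)"
        using coloring[OF step.hyps(1)] coloring[OF recolors.step[OF step.hyps]]
        unfolding recoloring_graph_def by simp
      from R.arc_implies_awalk[OF this] have "R.awalk d [(d, d(v := x))] (d(v := x))" by simp
      then have "R.awalk c (p @ [(d, d(v := x))]) (d(v := x))" using R.awalk_appendI p(1) by blast
      moreover have "length (p @ [(d, d(v := x))]) \<le> sum (n(v := Suc (n v))) (pverts G)"
        unfolding sum using p(2) by simp
      ultimately show ?thesis by blast
    qed
  qed
qed

lemma short_awalk:
  assumes G: "pair_graph G" and free: "free_of two_K2 G" "free_of diamond G"
    and l: "l \<ge> chromatic_number G + 1" and cd: "c \<in> colorings G l" "d \<in> colorings G l"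
  shows "\<exists>p. pre_digraph.awalk (with_proj (recoloring_graph G l)) c p d
    \<and> length p \<le> 2 * card (pverts G) ^ 2"
proof -
  interpret G: pair_graph G by (rule G)
  interpret simple_graph "\<lambda>u v. (u, v) \<in> parcs G" using simple_graph_parcs[OF G] .
  obtain h where "h \<in> colorings G (chromatic_number G)"
    using colorings_chromatic_number_nonempty[OF G] by blast
  then have "proper (pverts G) {1..chromatic_number G} h" unfolding colorings_iff_proper[OF G] by blast
  moreover have "card {1..chromatic_number G} < card {1..l}" using l by simp
  ultimately have "\<exists>M h. finite M \<and> card M < card {1..l} \<and> proper (pverts G) M h"
    using finite_atLeastAtMost by blast
  then have "reaches (pverts G) {1..l} (2 * card (pverts G)) c d"
    using reaches_of_free[OF G.pair_finite_verts finite_atLeastAtMost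
        two_K2_free_on_pverts[OF G free(1)] diamond_free_on_pverts[OF G free(2)]]
      cd unfolding colorings_iff_proper[OF G] by simp
  then obtain n where n: "recolors (pverts G) {1..l} c n d" "\<And>v. n v \<le> 2 * card (pverts G)"
    unfolding reaches_def by blast
  obtain p where p: "pre_digraph.awalk (with_proj (recoloring_graph G l)) c p d" "length p \<le> sum n (pverts G)"
    using awalk_of_recolors[OF G cd(1) n(1)] by blast
  note p(2)
  also have "sum n (pverts G) \<le> card (pverts G) * (2 * card (pverts G))"
    using sum_bounded_above[of "pverts G" n "2 * card (pverts G)"] n(2) by simp
  also have "\<dots> = 2 * card (pverts G) ^ 2" by (simp add: power2_eq_square)
  finally show ?thesis using p(1) by blast
qed

theorem theorem12:
  fixes G :: "'a pair_pre_digraph" and n :: nat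
  assumes "pair_graph G"
    and "card (pverts G) = n"
    and "free_of two_K2 G"
    and "free_of diamond G"
  shows "recolorable G \<and>
    (\<forall>l \<ge> chromatic_number G + 1. diameter (recoloring_graph G l) \<le> ereal (2 * real n ^ 2))"
proof -
  have "Digraph_Component.connected (with_proj (recoloring_graph G l))
      \<and> diameter (recoloring_graph G l) \<le> ereal (2 * real n ^ 2)"
    if l: "l \<ge> chromatic_number G + 1" for l
  proof
    interpret R: pair_graph "recoloring_graph G l" using pair_graph_recoloring_graph[OF assms(1)] .
    have verts: "pverts (recoloring_graph G l) = colorings G l" unfolding recoloring_graph_def by simp
    note walk = short_awalk[OF assms(1,3,4) l]
    \<comment> \<open>Connectedness includes that there is a vertex at all; an optimal coloring is
      also an \<open>l\<close>-coloring.\<close>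
    obtain h where "h \<in> colorings G (chromatic_number G)"
      using colorings_chromatic_number_nonempty[OF assms(1)] by blast
    then have "h \<in> colorings G l"
      using l unfolding colorings_def by (auto simp: PiE_iff)
    moreover have "u \<rightarrow>\<^sup>*\<^bsub>with_proj (mk_symmetric (recoloring_graph G l))\<^esub> v"
      if "u \<in> colorings G l" "v \<in> colorings G l" for u v
      using walk[OF that] R.reachable_awalkI R.reachable_mk_symmetricI by blast
    moreover have "pverts (mk_symmetric (recoloring_graph G l)) = colorings G l"
      by (simp add: mk_symmetric_def verts)
    ultimately show "Digraph_Component.connected (with_proj (recoloring_graph G l))"
      unfolding Digraph_Component.connected_def by (intro strongly_connectedI) auto
    show "diameter (recoloring_graph G l) \<le> ereal (2 * real n ^ 2)"
      unfolding diameter_def verts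
    proof (rule SUP_least)
      fix uv assume "uv \<in> colorings G l \<times> colorings G l"
      then obtain u v where uv: "uv = (u, v)" "u \<in> colorings G l" "v \<in> colorings G l" by blast
      obtain p where p: "R.awalk u p v" "length p \<le> 2 * card (pverts G) ^ 2" using walk[OF uv(2,3)] by blast
      \<comment> \<open>With unit weights the cost of a walk is its length, and the distance is at
        most the cost of any walk.\<close>
      have "R.awalk_cost (\<lambda>_. 1) p = real (length p)"
        unfolding R.awalk_cost_def by (simp add: sum_list_triv)
      also have "\<dots> \<le> real (2 * card (pverts G) ^ 2)" using p(2) by (rule of_nat_mono)
      also have "\<dots> = 2 * real n ^ 2" using assms(2) by simp
      finally have "ereal (R.awalk_cost (\<lambda>_. 1) p) \<le> ereal (2 * real n ^ 2)" by simp
      then have "R.\<mu> (\<lambda>_. 1) u v \<le> ereal (2 * real n ^ 2)"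
        using R.min_cost_le_walk_cost[OF p(1), of "\<lambda>_. 1"] by (rule order_trans[rotated])
      then show "(case uv of (u, v) \<Rightarrow> R.\<mu> (\<lambda>_. 1) u v) \<le> ereal (2 * real n ^ 2)"
        using uv(1) by simp
    qed
  qed
  then show ?thesis unfolding recolorable_def by blast
qed

end
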